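(* Assume: $p(\cdot\,|x,a)$ is continuous in $(x,a)$ with respect to total variation distance; $c(\cdot,a)$ is $K_c$-Lipschitz and $d_l(\cdot,a)$ is $K_l$-Lipschitz on $\mathsf X$ for all $a\in\mathsf A$ and $l=1,\dots,q$; and $\|p(\cdot\,|x,a)-p(\cdot\,|y,a)\|_{TV}\le G_p\,d_{\mathsf X}(x,y)$ for all $x,y\in\mathsf X$, $a\in\mathsf A$, for some constant $G_p$. Consider the discounted cost criterion. Put $$K=\frac{2\|c\|}{\min_l\alpha'_l},\quad H_c=\Bigl(K_c+\frac{\|c\|G_p}{1-\beta}\Bigr)2\alpha,\quad H_{d_l}=\Bigl(K_l+\frac{\|d_l\|G_p}{1-\beta}\Bigr)2\alpha,\quad H^{\max}=\max_{l=1,\dots,q}H_{d_l},$$ and let $Y_v$ be the constant of the rate-of-convergence bound for the discounted optimal value (described in the context). Given any $\kappa>0$, let $\varepsilon=\frac{\kappa}{3K}<\min_{l=1,\dots,q}\alpha'_l$ and $$n\ge\max\Bigl(\Bigl(\frac{3Y_v}{\kappa}\Bigr)^d,\Bigl(\frac{3H_c}{\kappa}\Bigr)^d,\Bigl(\frac{3H^{\max}K}{\kappa}\Bigr)^d\Bigr).$$ If $\overline\varphi_n$ is an optimal policy for $(\overline{\mathbf{CP}}_n^{\mathbf k-\varepsilon\mathbf 1})$ obtained by extending to $\mathsf X$ an optimal policy $\varphi_n\in\Phi_n$ for $(\mathbf{CP}_n^{\mathbf k-\varepsilon\mathbf 1})$, then $\overline\varphi_n\in\Phi$ is feasible for $(\mathbf{CP}^{\mathbf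 k})$ and the true cost $J(\overline\varphi_n,\gamma)$ of $\overline\varphi_n$ is within $\kappa$ of the optimal value of $(\mathbf{CP}^{\mathbf k})$.
   Context: **Model.** $\mathsf X$ (states) is a compact subset of $\mathbb R^d$, $d\ge1$, with Euclidean distance $d_{\mathsf X}$; $\mathsf A$ (actions) is a compact metric space; every action is admissible in every state. $p(\cdot\,|x,a)$ is a stochastic kernel on $\mathsf X$ given $\mathsf X\times\mathsf A$ (transition probability); $c,d_1,\dots,d_q:\mathsf X\times\mathsf A\to[0,\infty)$ are continuous; $\gamma$ is a probability measure on $\mathsf X$ (initial distribution); $\mathbf k=(k_1,\dots,k_q)\in[0,\infty)^q$; $\mathbf 1=(1,\dots,1)\in\mathbb R^q$. A policy $\pi=\{\pi_t\}$ is a sequence of stochastic kernels on $\mathsf A$ given the history spaces $\mathsf H_t=(\mathsf X\times\mathsf A)^t\times\mathsf X$; $\Pi$ is the set of all policies; $\Phi$ is the set of stochastic kernels on $\mathsf A$ given $\mathsf X$, identified with the randomized stationary policies. $\mathbb E_\gamma^\pi$ is expectation under the law of $(X_t,A_t)_{t\ge0}$ determined by $\gamma$, $\pi$, $p$. $\|\cdot\|$ is the sup norm; $\|\mu\|_{TV}=\sup\{|\int g\,d\mu|:\|g\|\le1\}$ for finite signed measures $\mu$. **Discounted criterion.** Fix $\beta\in(0,1)$. $J(\pi,\gamma)=(1-\beta)\mathbb E_\gamma^\pi[\sum_{t\ge0}\beta^tc(X_t,A_t)]$, and $J_l(\pi,\gamma)$ is the same with $d_l$ in place of $c$. For $\mathbf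 m\in\mathbb R^q$, $(\mathbf{CP}^{\mathbf m})$: minimize $J(\pi,\gamma)$ over $\pi\in\Pi$ subject to $J_l(\pi,\gamma)\le m_l$, $l=1,\dots,q$. Standing assumption: there are $\pi\in\Pi$ and $\boldsymbol\alpha'=(\alpha_1',\dots,\alpha_q')$ with all $\alpha'_l>0$ such that $J_l(\pi,\gamma)+\alpha'_l=k_l$ for all $l$; this $\boldsymbol\alpha'$ is fixed. **Finite models.** $\alpha>0$ is a constant and, for each $n\ge1$, $\mathsf X_n=\{x_{n,1},\dots,x_{n,n}\}\subset\mathsf X$ is a set of cardinality $n$ with $\max_{x\in\mathsf X}\min_{y\in\mathsf X_n}d_{\mathsf X}(x,y)\le\alpha(1/n)^{1/d}$. $Q_n:\mathsf X\to\mathsf X_n$ is a nearest-point map (ties broken so that $Q_n$ is measurable); $\mathcal S_{n,i}=Q_n^{-1}(x_{n,i})$; $i_n(x)$ is the index with $x\in\mathcal S_{n,i_n(x)}$. $\nu_n$ is a measure on $\mathsf X$ with $\nu_n(\mathcal S_{n,i})>0$ for all $i$, and $\nu_{n,i}(\cdot)=\nu_n(\cdot)/\nu_n(\mathcal S_{n,i})$ is the probability measure on $\mathcal S_{n,i}$ obtained by restricting and normalizing $\nu_n$. MDP$_n$ has state space $\mathsf X_n$, action space $\mathsf A$, initial distribution $\gamma_n=\gamma\circ Q_n^{-1}$, and $p_n(x_{n,j}|x_{n,i},a)=\int_{\mathcal S_{n,i}}p(\mathcal S_{n,j}|x,a)\,\nu_{n,i}(dx)$, $c_n(x_{n,i},a)=\int_{\mathcal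 S_{n,i}}c(x,a)\,\nu_{n,i}(dx)$, $d_{l,n}(x_{n,i},a)=\int_{\mathcal S_{n,i}}d_l(x,a)\,\nu_{n,i}(dx)$. Its policies $\Pi_n$, randomized stationary policies $\Phi_n$ and discounted costs $J_n,J_{l,n}$ are defined as for the original model. $(\mathbf{CP}_n^{\mathbf m})$: minimize $J_n(\pi,\gamma_n)$ over $\pi\in\Pi_n$ subject to $J_{l,n}(\pi,\gamma_n)\le m_l$ for all $l$. The extension of $\varphi\in\Phi_n$ to $\mathsf X$ is $\overline\varphi\in\Phi$, $\overline\varphi(\cdot|x)=\varphi(\cdot|Q_n(x))$. $\min(\cdot)$ denotes the optimal value. **The model $\overline{\text{MDP}}_n$** has state space $\mathsf X$, action space $\mathsf A$, initial distribution $\gamma$, transition kernel $q_n(\cdot|x,a)=\int p(\cdot|z,a)\,\nu_{n,i_n(x)}(dz)$, cost $b_n(x,a)=\int c(z,a)\,\nu_{n,i_n(x)}(dz)$ and constraint functions $r_{l,n}(x,a)=\int d_l(z,a)\,\nu_{n,i_n(x)}(dz)$. $(\overline{\mathbf{CP}}_n^{\mathbf m})$: minimize over $\pi\in\Pi$ the $\beta$-discounted (normalized by $1-\beta$) cost of $b_n$ in $\overline{\text{MDP}}_n$ subject to the $\beta$-discounted (normalized) cost of $r_{l,n}$ in $\overline{\text{MDP}}_n$ being at most $m_l$ for all $l$. **The constant $Y_v$.** $Y_v$ is the constant in the bound $|\min(\mathbf{CP}_n^{\mathbf m})-\min(\mathbf{CP}^{\mathbf m})|\le Y_v(1/n)^{1/d}$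 for the discounted optimal value, used for $\mathbf m=\mathbf k$ and for the tightened vector $\mathbf m=\mathbf k-\varepsilon\mathbf 1$. If $p(\cdot|x,a)$ is $K_p$-Lipschitz in $x$, uniformly in $a$, for the Wasserstein distance of order 1 with $K_p\beta<1$, it is given by $Y_v=4\alpha(K_c+qK\max_lK_l)/(1-\beta K_p)$; if instead $p(\cdot|x,a)$ is Lipschitz in $x$, uniformly in $a$, for total variation (as assumed here), the bound holds with a possibly different constant in place of this one, and no condition $K_p\beta<1$ is needed. *)

theory Defs
  imports "HOL-Probability.Probability"
begin

text \<open>Constrained Markov decision processes in which every action is admissible in every state.
  State and action spaces are measurable spaces; kernels are measurable maps into
  \<^const>\<open>prob_algebra\<close>, i.e. stochastic kernels.\<close>

record ('x, 'a, 'l) cmdp =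
  states :: "'x measure"
  actions :: "'a measure"
  trans :: "'x \<times> 'a \<Rightarrow> 'x measure"
  init :: "'x measure"
  cost :: "'x \<times> 'a \<Rightarrow> real"
  constr :: "'l \<Rightarrow> 'x \<times> 'a \<Rightarrow> real"

definition pair_space :: "('x, 'a, 'l) cmdp \<Rightarrow> ('x \<times> 'a) measure" where
  "pair_space M = states M \<Otimes>\<^sub>M actions M"

text \<open>The history up to time \<open>t\<close> is a pair \<open>(h, x)\<close>, where \<open>h i\<close> is the state-action pair at
  time \<open>i < t\<close> and \<open>x\<close> is the state at time \<open>t\<close>.\<close>

definition policies :: "('x, 'a, 'l) cmdp \<Rightarrow> (nat \<Rightarrow> (nat \<Rightarrow> 'x \<times> 'a) \<times> 'x \<Rightarrow> 'a measure) set" where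
  "policies M = {\<pi>. \<forall>t. \<pi> t \<in>
     PiM {0..<t} (\<lambda>_. pair_space M) \<Otimes>\<^sub>M states M \<rightarrow>\<^sub>M prob_algebra (actions M)}"

definition stationary_kernels :: "('x, 'a, 'l) cmdp \<Rightarrow> ('x \<Rightarrow> 'a measure) set" where
  "stationary_kernels M = states M \<rightarrow>\<^sub>M prob_algebra (actions M)"

definition stationary_policy :: "('x \<Rightarrow> 'a measure) \<Rightarrow> nat \<Rightarrow> (nat \<Rightarrow> 'x \<times> 'a) \<times> 'x \<Rightarrow> 'a measure" where
  "stationary_policy \<phi> = (\<lambda>t (h, x). \<phi> x)"

text \<open>Conditional distribution of the state-action pair at time \<open>t\<close>, given the pairs before \<open>t\<close>.\<close>

definition step_kernel ::
    "('x, 'a, 'l) cmdp \<Rightarrow> (nat \<Rightarrow> (nat \<Rightarrow> 'x \<times> 'a) \<times> 'x \<Rightarrow> 'a measure) \<Rightarrow>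
     nat \<Rightarrow> (nat \<Rightarrow> 'x \<times> 'a) \<Rightarrow> ('x \<times> 'a) measure" where
  "step_kernel M \<pi> t h =
     (if t = 0 then init M else trans M (h (t - 1))) \<bind>
       (\<lambda>x. \<pi> t (h, x) \<bind> (\<lambda>a. return (pair_space M) (x, a)))"

text \<open>The law of the process of state-action pairs on the infinite product space, i.e. the
  projective limit given by the Ionescu-Tulcea theorem.\<close>

definition law ::
    "('x, 'a, 'l) cmdp \<Rightarrow> (nat \<Rightarrow> (nat \<Rightarrow> 'x \<times> 'a) \<times> 'x \<Rightarrow> 'a measure) \<Rightarrow> (nat \<Rightarrow> 'x \<times> 'a) measure" where
  "law M \<pi> = projective_family.lim UNIV
     (Ionescu_Tulcea.CI (step_kernel M \<pi>) (\<lambda>_. pair_space M)) (\<lambda>_. pair_space M)"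

definition disc ::
    "real \<Rightarrow> ('x, 'a, 'l) cmdp \<Rightarrow> ('x \<times> 'a \<Rightarrow> real) \<Rightarrow>
     (nat \<Rightarrow> (nat \<Rightarrow> 'x \<times> 'a) \<times> 'x \<Rightarrow> 'a measure) \<Rightarrow> real" where
  "disc \<beta> M f \<pi> = (1 - \<beta>) * (\<integral>\<omega>. (\<Sum>t. \<beta> ^ t * f (\<omega> t)) \<partial>law M \<pi>)"

definition feasible ::
    "real \<Rightarrow> ('x, 'a, 'l::finite) cmdp \<Rightarrow> real ^ 'l \<Rightarrow>
     (nat \<Rightarrow> (nat \<Rightarrow> 'x \<times> 'a) \<times> 'x \<Rightarrow> 'a measure) set" where
  "feasible \<beta> M m = {\<pi> \<in> policies M. \<forall>l. disc \<beta> M (constr M l) \<pi> \<le> m $ l}"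

definition opt_value :: "real \<Rightarrow> ('x, 'a, 'l::finite) cmdp \<Rightarrow> real ^ 'l \<Rightarrow> real" where
  "opt_value \<beta> M m = (INF \<pi>\<in>feasible \<beta> M m. disc \<beta> M (cost M) \<pi>)"

definition optimal ::
    "real \<Rightarrow> ('x, 'a, 'l::finite) cmdp \<Rightarrow> real ^ 'l \<Rightarrow>
     (nat \<Rightarrow> (nat \<Rightarrow> 'x \<times> 'a) \<times> 'x \<Rightarrow> 'a measure) \<Rightarrow> bool" where
  "optimal \<beta> M m \<pi> \<longleftrightarrow> \<pi> \<in> feasible \<beta> M m \<and>
     (\<forall>\<pi>'\<in>feasible \<beta> M m. disc \<beta> M (cost M) \<pi> \<le> disc \<beta> M (cost M) \<pi>')"

text \<open>Quantization. The cells are indexed by the grid points themselves, so that the index of the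
  cell containing \<open>x\<close> is \<open>Q x\<close>. In \<open>cell_measure\<close> the name
  \<^const>\<open>uniform_measure\<close> means: \<open>\<nu>\<close> restricted to the cell and normalized.\<close>

definition cell :: "('x, 'a, 'l) cmdp \<Rightarrow> ('x \<Rightarrow> 'x) \<Rightarrow> 'x \<Rightarrow> 'x set" where
  "cell M Q y = {x \<in> space (states M). Q x = y}"

definition cell_measure :: "('x, 'a, 'l) cmdp \<Rightarrow> ('x \<Rightarrow> 'x) \<Rightarrow> 'x measure \<Rightarrow> 'x \<Rightarrow> 'x measure" where
  "cell_measure M Q \<nu> y = uniform_measure \<nu> (cell M Q y)"

definition finite_model ::
    "('x, 'a, 'l) cmdp \<Rightarrow> 'x set \<Rightarrow> ('x \<Rightarrow> 'x) \<Rightarrow> 'x measure \<Rightarrow> ('x, 'a, 'l) cmdp" where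
  "finite_model M G Q \<nu> = \<lparr>
     states = count_space G,
     actions = actions M,
     trans = (\<lambda>(y, a). point_measure G
       (\<lambda>y'. ennreal (\<integral>z. measure (trans M (z, a)) (cell M Q y') \<partial>cell_measure M Q \<nu> y))),
     init = distr (init M) (count_space G) Q,
     cost = (\<lambda>(y, a). \<integral>z. cost M (z, a) \<partial>cell_measure M Q \<nu> y),
     constr = (\<lambda>l (y, a). \<integral>z. constr M l (z, a) \<partial>cell_measure M Q \<nu> y)\<rparr>"

definition averaged_model ::
    "('x, 'a, 'l) cmdp \<Rightarrow> ('x \<Rightarrow> 'x) \<Rightarrow> 'x measure \<Rightarrow> ('x, 'a, 'l) cmdp" where
  "averaged_model M Q \<nu> = \<lparr>
     states = states M,
     actions = actions M,
     trans = (\<lambda>(x, a). cell_measure M Q \<nu> (Q x) \<bind> (\<lambda>z. trans M (z, a))),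
     init = init M,
     cost = (\<lambda>(x, a). \<integral>z. cost M (z, a) \<partial>cell_measure M Q \<nu> (Q x)),
     constr = (\<lambda>l (x, a). \<integral>z. constr M l (z, a) \<partial>cell_measure M Q \<nu> (Q x))\<rparr>"

definition extension :: "('x \<Rightarrow> 'x) \<Rightarrow> ('x \<Rightarrow> 'a measure) \<Rightarrow> 'x \<Rightarrow> 'a measure" where
  "extension Q \<phi> = (\<lambda>x. \<phi> (Q x))"

text \<open>\<open>tv_dist P R\<close> is the total variation norm of the signed measure \<open>P - R\<close>, normalized as the
  dual of the sup norm: two mutually singular probability measures are at distance 2.\<close>

definition tv_dist :: "'x measure \<Rightarrow> 'x measure \<Rightarrow> real" where
  "tv_dist P R = (SUP g\<in>{g \<in> borel_measurable P. \<forall>x\<in>space P. \<bar>g x\<bar> \<le> 1}.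
     \<bar>(\<integral>x. g x \<partial>P) - (\<integral>x. g x \<partial>R)\<bar>)"

definition sup_norm_on :: "'z set \<Rightarrow> ('z \<Rightarrow> real) \<Rightarrow> real" where
  "sup_norm_on S f = (SUP z\<in>S. \<bar>f z\<bar>)"

end

theory Submission
  imports Defs
begin

text \<open>
  Write \<open>J\<close> for the discounted cost in the original model, \<open>J\<^sub>n\<close> for the discounted cost in the
  averaged model, which replaces the data at a state by their mean over its cell, and \<open>\<psi>\<close> for the
  extended policy. Three gaps, each at most \<open>\<kappa>/3\<close>, separate \<open>J(\<psi>)\<close> from the optimal value under the
  constraint vector \<open>k\<close>:

  \<^item> \<open>J(\<psi>)\<close> versus \<open>J\<^sub>n(\<psi>)\<close>. Under a fixed stationary policy the two models are Markov chains with
    the same initial law whose one-step kernels differ in total variation by at most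
    \<open>G\<^sub>p\<close> times the diameter of a cell. These errors add up, so the laws at time \<open>t\<close> differ by at most
    \<open>t\<close> times that amount, and the discounted sum of \<open>t + 1\<close> produces the factor \<open>1/(1-\<beta>)\<close> in the
    constants \<open>H\<close> (\<open>marginals_close\<close>, \<open>disc_close\<close>). The same estimate for the constraint functions
    costs at most \<open>\<epsilon>\<close>, which is exactly what the tightening of \<open>k\<close> to \<open>k - \<epsilon>\<close> pays for; hence
    \<open>\<psi>\<close> is feasible.

  \<^item> \<open>J\<^sub>n(\<psi>)\<close> versus the optimal value of the original model under \<open>k - \<epsilon>\<close>. The averaged data are
    constant on cells, so the chain of cells visited under \<open>\<psi>\<close> is itself Markov and is the chain
    of the finite model under \<open>\<phi>\<close> (\<open>disc_lump\<close>). Therefore \<open>J\<^sub>n(\<psi>)\<close> is the optimal value of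
    the finite model, and the assumed rate of convergence applies.

  \<^item> The optimal values of the original model under \<open>k - \<epsilon>\<close> and under \<open>k\<close>. Mixing a policy that is
    feasible for \<open>k\<close> with the Slater policy, with weight \<open>\<epsilon> / min \<alpha>'\<close> on the latter, gives a policy that
    is feasible for \<open>k - \<epsilon>\<close> and costs at most \<open>\<epsilon> \<parallel>c\<parallel> / min \<alpha>'\<close> more (\<open>opt_value_tighten\<close>).

  The mixing is the delicate point: tossing a coin once and then following one of two policies is not a
  policy, because the coin is not part of the history. It is replaced by a policy that at each time mixes
  the two action laws with the posterior weights of the coin given the history (\<open>mixed_policy\<close>). These
  weights are Radon-Nikodym derivatives of the two history laws with respect to their mixture.
\<close>

section \<open>Probability measures and kernels\<close>

text \<open>Writing the convex combination \<open>r P + (1 - r) R\<close> as a random choice makes countable additivity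
  and the integration rules instances of those for the Giry monad.\<close>

definition mixture :: "real \<Rightarrow> 'z measure \<Rightarrow> 'z measure \<Rightarrow> 'z measure" where
  "mixture r P R = measure_pmf (bernoulli_pmf r) \<bind> (\<lambda>b. if b then P else R)"

lemma mixture_components_measurable:
  assumes "P \<in> space (prob_algebra N)" "R \<in> space (prob_algebra N)"
  shows "(\<lambda>b. if b then P else R) \<in> measure_pmf (bernoulli_pmf r) \<rightarrow>\<^sub>M prob_algebra N"
  using assms by (intro measurableI) (auto split: if_splits)

lemma mixture_in_prob_algebra:
  assumes "P \<in> space (prob_algebra N)" "R \<in> space (prob_algebra N)"
  shows "mixture r P R \<in> space (prob_algebra N)"
proof -
  have m: "measure_pmf (bernoulli_pmf r) \<in> space (prob_algebra (measure_pmf (bernoulli_pmf r)))"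
    by (simp add: space_prob_algebra prob_space_measure_pmf)
  show ?thesis
    unfolding mixture_def
    using measurable_bind_prob_space[OF measurable_const[OF m] mixture_components_measurable[OF assms],
        THEN measurable_space, of undefined "count_space UNIV"]
    by simp
qed

lemma nn_integral_mixture:
  assumes "P \<in> space (prob_algebra N)" "R \<in> space (prob_algebra N)"
    and "0 \<le> r" "r \<le> 1" and g: "g \<in> borel_measurable N"
  shows "(\<integral>\<^sup>+x. g x \<partial>mixture r P R) =
    ennreal r * (\<integral>\<^sup>+x. g x \<partial>P) + ennreal (1 - r) * (\<integral>\<^sup>+x. g x \<partial>R)"
  unfolding mixture_def using assms(3,4)
  by (subst nn_integral_bind[OF g measurable_prob_algebraD[OF mixture_components_measurable[OF assms(1,2)]]])
    (simp add: mult.commute ennreal_minus ennreal_1[symmetric] del: ennreal_1)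

text \<open>Laws of processes are compared through integrals of nonnegative functions throughout, since these
  commute with the monadic bind under measurability alone.\<close>

lemma prob_algebra_eqI:
  assumes "P \<in> space (prob_algebra N)" "R \<in> space (prob_algebra N)"
    and eq: "\<And>g. g \<in> borel_measurable N \<Longrightarrow> (\<integral>\<^sup>+x. g x \<partial>P) = (\<integral>\<^sup>+x. g x \<partial>R)"
  shows "P = R"
proof (rule measure_eqI)
  show s: "sets P = sets R" using assms by (simp add: space_prob_algebra)
  fix B assume B: "B \<in> sets P"
  then have "indicator B \<in> borel_measurable N"
    using assms by (simp add: space_prob_algebra)
  from eq[OF this] show "emeasure P B = emeasure R B"
    using B s by (simp add: nn_integral_indicator)
qed

lemma mixture_kernel_measurable:
  assumes P: "P \<in> L \<rightarrow>\<^sub>M prob_algebra N" and R: "R \<in> L \<rightarrow>\<^sub>M prob_algebra N"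
    and w: "w \<in> borel_measurable L" and b: "\<And>x. x \<in> space L \<Longrightarrow> 0 \<le> w x \<and> w x \<le> 1"
  shows "(\<lambda>x. mixture (w x) (P x) (R x)) \<in> L \<rightarrow>\<^sub>M prob_algebra N"
proof (rule measurable_prob_algebraI)
  have sp: "mixture (w x) (P x) (R x) \<in> space (prob_algebra N)" if "x \<in> space L" for x
    using that measurable_space[OF P] measurable_space[OF R] by (intro mixture_in_prob_algebra)
  then show ps: "x \<in> space L \<Longrightarrow> prob_space (mixture (w x) (P x) (R x))" for x
    by (auto simp: space_prob_algebra)
  show "(\<lambda>x. mixture (w x) (P x) (R x)) \<in> L \<rightarrow>\<^sub>M subprob_algebra N"
  proof (rule measurable_subprob_algebra)
    show "x \<in> space L \<Longrightarrow> subprob_space (mixture (w x) (P x) (R x))" for x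
      using ps by (simp add: prob_space_imp_subprob_space)
    show "x \<in> space L \<Longrightarrow> sets (mixture (w x) (P x) (R x)) = sets N" for x
      using sp by (simp add: space_prob_algebra)
    fix B assume B: "B \<in> sets N"
    note [measurable] = measurable_prob_algebraD[OF P] measurable_prob_algebraD[OF R] w
    have "(\<lambda>x. ennreal (w x) * emeasure (P x) B + ennreal (1 - w x) * emeasure (R x) B) \<in> borel_measurable L"
      using B by measurable
    moreover have "emeasure (mixture (w x) (P x) (R x)) B =
        ennreal (w x) * emeasure (P x) B + ennreal (1 - w x) * emeasure (R x) B" if x: "x \<in> space L" for x
    proof -
      have PR: "P x \<in> space (prob_algebra N)" "R x \<in> space (prob_algebra N)"
        using x measurable_space[OF P] measurable_space[OF R] by auto
      then have "sets (P x) = sets N" "sets (R x) = sets N" by (auto simp: space_prob_algebra)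
      then show ?thesis
        using nn_integral_mixture[OF PR, of "w x" "indicator B"] b[OF x] B sp[OF x]
        by (simp add: space_prob_algebra)
    qed
    ultimately show "(\<lambda>x. emeasure (mixture (w x) (P x) (R x)) B) \<in> borel_measurable L"
      by (simp cong: measurable_cong)
  qed
qed

text \<open>\<open>w x\<close> is the conditional probability of the first component given the outcome \<open>x\<close>. The densities
  of \<open>r P\<close> and \<open>(1 - r) R\<close> with respect to their sum \<open>D\<close> add up to 1 only \<open>D\<close>-almost everywhere, so the
  first one is truncated at 1 and the second one is replaced by \<open>1 - w\<close>: the weights can then serve as
  mixing probabilities at every point.\<close>

lemma mixture_posterior:
  assumes P: "P \<in> space (prob_algebra N)" and R: "R \<in> space (prob_algebra N)"
    and r: "0 \<le> r" "r \<le> 1"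
  obtains w where "w \<in> borel_measurable N" "\<And>x. 0 \<le> w x" "\<And>x. w x \<le> 1"
    "\<And>g. g \<in> borel_measurable N \<Longrightarrow>
      (\<integral>\<^sup>+x. ennreal (w x) * g x \<partial>mixture r P R) = ennreal r * (\<integral>\<^sup>+x. g x \<partial>P)"
    "\<And>g. g \<in> borel_measurable N \<Longrightarrow>
      (\<integral>\<^sup>+x. ennreal (1 - w x) * g x \<partial>mixture r P R) = ennreal (1 - r) * (\<integral>\<^sup>+x. g x \<partial>R)"
proof -
  define D where "D = mixture r P R"
  have D: "D \<in> space (prob_algebra N)" unfolding D_def by (rule mixture_in_prob_algebra[OF P R])
  interpret D: prob_space D using D by (simp add: space_prob_algebra)
  have sP: "sets P = sets N" and sR: "sets R = sets N" and sD: "sets D = sets N"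
    using P R D by (auto simp: space_prob_algebra)
  note mcs = measurable_cong_sets[OF sP refl] measurable_cong_sets[OF sR refl] measurable_cong_sets[OF sD refl]
  have nnD: "(\<integral>\<^sup>+x. g x \<partial>D) = ennreal r * (\<integral>\<^sup>+x. g x \<partial>P) + ennreal (1 - r) * (\<integral>\<^sup>+x. g x \<partial>R)"
    if "g \<in> borel_measurable N" for g
    unfolding D_def by (rule nn_integral_mixture[OF P R r that])
  have eD: "emeasure D B = ennreal r * emeasure P B + ennreal (1 - r) * emeasure R B" if "B \<in> sets N" for B
    using nnD[of "indicator B"] that by (simp add: sP sR sD)
  have nP: "(\<integral>\<^sup>+x. g x \<partial>scale_measure (ennreal r) P) = ennreal r * (\<integral>\<^sup>+x. g x \<partial>P)"
    if "g \<in> borel_measurable N" for g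
    using that by (intro nn_integral_scale_measure) (simp add: mcs)
  have nR: "(\<integral>\<^sup>+x. g x \<partial>scale_measure (ennreal (1-r)) R) = ennreal (1-r) * (\<integral>\<^sup>+x. g x \<partial>R)"
    if "g \<in> borel_measurable N" for g
    using that by (intro nn_integral_scale_measure) (simp add: mcs)
  have acP: "absolutely_continuous D (scale_measure (ennreal r) P)"
    by (auto simp: absolutely_continuous_def null_sets_def sD sP eD)
  have acR: "absolutely_continuous D (scale_measure (ennreal (1-r)) R)"
    by (auto simp: absolutely_continuous_def null_sets_def sD sR eD)
  define f where "f = RN_deriv D (scale_measure (ennreal r) P)"
  define h where "h = RN_deriv D (scale_measure (ennreal (1-r)) R)"
  have [measurable]: "f \<in> borel_measurable D" "h \<in> borel_measurable D"
    by (auto simp: f_def h_def)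
  have f: "(\<integral>\<^sup>+x. f x * g x \<partial>D) = ennreal r * (\<integral>\<^sup>+x. g x \<partial>P)" if "g \<in> borel_measurable N" for g
    unfolding f_def using that
    by (subst D.RN_deriv_nn_integral[OF acP, symmetric]) (auto simp: nP sP sD mcs)
  have h: "(\<integral>\<^sup>+x. h x * g x \<partial>D) = ennreal (1-r) * (\<integral>\<^sup>+x. g x \<partial>R)" if "g \<in> borel_measurable N" for g
    unfolding h_def using that
    by (subst D.RN_deriv_nn_integral[OF acR, symmetric]) (auto simp: nR sR sD mcs)
  have AE: "AE x in D. f x + h x = 1"
  proof (rule D.density_unique_finite_measure)
    fix B assume "B \<in> sets D"
    then have B[measurable]: "B \<in> sets N" "B \<in> sets D" by (auto simp: sD)
    have "(\<integral>\<^sup>+x. (f x + h x) * indicator B x \<partial>D) =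
      (\<integral>\<^sup>+x. f x * indicator B x \<partial>D) + (\<integral>\<^sup>+x. h x * indicator B x \<partial>D)"
      by (simp add: distrib_right nn_integral_add)
    also have "\<dots> = (\<integral>\<^sup>+x. 1 * indicator B x \<partial>D)"
      using f[of "indicator B"] h[of "indicator B"] nnD[of "indicator B"] by simp
    finally show "(\<integral>\<^sup>+x. (f x + h x) * indicator B x \<partial>D) = (\<integral>\<^sup>+x. 1 * indicator B x \<partial>D)" .
  qed auto
  define w where "w x = enn2real (min 1 (f x))" for x
  have fin: "min 1 (f x) < \<top>" for x by (simp add: min_less_iff_disj)
  have w: "ennreal (w x) = min 1 (f x)" for x
    unfolding w_def using fin[of x] by simp
  have AEw: "AE x in D. ennreal (w x) = f x" and AEh: "AE x in D. ennreal (1 - w x) = h x"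
  proof -
    have *: "ennreal (w x) = f x \<and> ennreal (1 - w x) = h x" if e: "f x + h x = 1" for x
    proof -
      have le: "f x \<le> 1" unfolding e[symmetric] by simp
      have "f x \<noteq> \<top>" using neq_top_trans[OF ennreal_one_neq_top le] .
      have wf: "ennreal (w x) = f x" using le by (simp add: w min.absorb2)
      have "ennreal (1 - w x) = 1 - f x"
        using wf by (simp add: ennreal_minus[symmetric] w_def)
      also have "\<dots> = h x"
        unfolding e[symmetric] using \<open>f x \<noteq> \<top>\<close> by (rule ennreal_add_diff_cancel_left)
      finally show ?thesis using wf by simp
    qed
    show "AE x in D. ennreal (w x) = f x" "AE x in D. ennreal (1 - w x) = h x"
      using AE by (auto elim!: eventually_mono dest: *)
  qed
  show ?thesis
  proof (rule that[of w])
    have "w \<in> borel_measurable D" unfolding w_def by measurable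
    then show "w \<in> borel_measurable N" by (simp add: mcs)
    show "0 \<le> w x" for x by (simp add: w_def)
    show "w x \<le> 1" for x unfolding w_def using enn2real_mono[of "min 1 (f x)" 1] by simp
    fix g :: "'a \<Rightarrow> ennreal" assume g: "g \<in> borel_measurable N"
    have "(\<integral>\<^sup>+x. ennreal (w x) * g x \<partial>D) = (\<integral>\<^sup>+x. f x * g x \<partial>D)"
      using AEw by (intro nn_integral_cong_AE) auto
    with f[OF g] show "(\<integral>\<^sup>+x. ennreal (w x) * g x \<partial>mixture r P R) = ennreal r * (\<integral>\<^sup>+x. g x \<partial>P)"
      by (simp add: D_def)
    have "(\<integral>\<^sup>+x. ennreal (1 - w x) * g x \<partial>D) = (\<integral>\<^sup>+x. h x * g x \<partial>D)"
      using AEh by (intro nn_integral_cong_AE) auto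
    with h[OF g] show "(\<integral>\<^sup>+x. ennreal (1 - w x) * g x \<partial>mixture r P R) = ennreal (1 - r) * (\<integral>\<^sup>+x. g x \<partial>R)"
      by (simp add: D_def)
  qed
qed

lemma integral_mixture:
  fixes g :: "'z \<Rightarrow> real"
  assumes P: "P \<in> space (prob_algebra N)" and R: "R \<in> space (prob_algebra N)"
    and r: "0 \<le> r" "r \<le> 1" and g: "g \<in> borel_measurable N"
    and B: "\<And>x. x \<in> space N \<Longrightarrow> \<bar>g x\<bar> \<le> B"
  shows "(\<integral>x. g x \<partial>mixture r P R) = r * (\<integral>x. g x \<partial>P) + (1 - r) * (\<integral>x. g x \<partial>R)"
  unfolding mixture_def using r
  by (subst integral_bind[where K=N and B=B and B'=1])
    (use P R in \<open>auto intro!: g B measurable_prob_algebraD[OF mixture_components_measurable]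
       measure_pmf.finite_measure_axioms simp: space_prob_algebra space_subprob_algebra prob_space_imp_subprob_space
         prob_space.emeasure_space_1\<close>)

lemma abs_integral_prob_le:
  fixes f :: "'x \<Rightarrow> real"
  assumes P: "P \<in> space (prob_algebra N)" and f: "f \<in> borel_measurable N"
    and B: "AE x in P. \<bar>f x\<bar> \<le> B"
  shows "\<bar>\<integral>x. f x \<partial>P\<bar> \<le> B" "integrable P f"
proof -
  interpret prob_space P using P by (simp add: space_prob_algebra)
  have s: "sets P = sets N" using P by (simp add: space_prob_algebra)
  have "AE x in P. 0 \<le> B" using B by eventually_elim auto
  then have B0: "0 \<le> B" by simp
  show i: "integrable P f"
    by (rule integrable_const_bound[where B=B]) (use B f in \<open>auto simp: measurable_cong_sets[OF s refl]\<close>)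
  have "\<bar>\<integral>x. f x \<partial>P\<bar> \<le> (\<integral>x. \<bar>f x\<bar> \<partial>P)" by (rule integral_abs_bound)
  also have "\<dots> \<le> (\<integral>x. B \<partial>P)" using i B by (intro integral_mono_AE) auto
  finally show "\<bar>\<integral>x. f x \<partial>P\<bar> \<le> B" by (simp add: prob_space)
qed

lemma integral_measurable_kernel:
  fixes f :: "'x \<Rightarrow> 'y \<Rightarrow> real"
  assumes f: "(\<lambda>(x, y). f x y) \<in> borel_measurable (M \<Otimes>\<^sub>M N)"
    and L: "L \<in> M \<rightarrow>\<^sub>M subprob_algebra N"
  shows "(\<lambda>x. \<integral>y. f x y \<partial>L x) \<in> borel_measurable M"
proof -
  have "(\<lambda>x. distr (L x) (M \<Otimes>\<^sub>M N) (\<lambda>y. (x, y))) \<in> M \<rightarrow>\<^sub>M subprob_algebra (M \<Otimes>\<^sub>M N)"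
    by (rule measurable_distr2[OF _ L]) simp
  from measurable_compose[OF this integral_measurable_subprob_algebra[OF f]]
  have "(\<lambda>x. \<integral>z. (case z of (x, y) \<Rightarrow> f x y) \<partial>distr (L x) (M \<Otimes>\<^sub>M N) (\<lambda>y. (x, y))) \<in> borel_measurable M" .
  moreover have "(\<integral>z. (case z of (x, y) \<Rightarrow> f x y) \<partial>distr (L x) (M \<Otimes>\<^sub>M N) (\<lambda>y. (x, y))) = (\<integral>y. f x y \<partial>L x)"
    if "x \<in> space M" for x
  proof -
    have "(\<lambda>y. (x, y)) \<in> L x \<rightarrow>\<^sub>M M \<Otimes>\<^sub>M N"
      unfolding subprob_measurableD(3)[OF L that] using that by simp
    then show ?thesis by (simp add: integral_distr[OF _ f])
  qed
  ultimately show ?thesis by (simp cong: measurable_cong)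
qed

text \<open>The supremum defining \<open>tv_dist\<close> runs over functions bounded by 1; the bound for \<open>g\<close> is that for
  \<open>g / B\<close>. The case \<open>B = 0\<close> is separate because \<open>g / 0\<close> carries no information about \<open>g\<close>.\<close>

lemma bounded_integral_diff_le_tv_dist:
  fixes g :: "'x \<Rightarrow> real"
  assumes P: "P \<in> space (prob_algebra N)" and R: "R \<in> space (prob_algebra N)"
    and g: "g \<in> borel_measurable N" and B: "\<And>x. x \<in> space N \<Longrightarrow> \<bar>g x\<bar> \<le> B"
  shows "\<bar>(\<integral>x. g x \<partial>P) - (\<integral>x. g x \<partial>R)\<bar> \<le> B * tv_dist P R"
proof -
  have sP: "sets P = sets N" and sR: "sets R = sets N" using P R by (auto simp: space_prob_algebra)
  note spc = sets_eq_imp_space_eq[OF sP] sets_eq_imp_space_eq[OF sR]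
  interpret P: prob_space P using P by (simp add: space_prob_algebra)
  interpret R: prob_space R using R by (simp add: space_prob_algebra)
  let ?S = "{g \<in> borel_measurable P. \<forall>x\<in>space P. \<bar>g x :: real\<bar> \<le> 1}"
  let ?F = "\<lambda>g :: 'x \<Rightarrow> real. \<bar>(\<integral>x. g x \<partial>P) - (\<integral>x. g x \<partial>R)\<bar>"
  have le1: "\<bar>\<integral>x. h x \<partial>P\<bar> \<le> 1" "\<bar>\<integral>x. h x \<partial>R\<bar> \<le> 1" if "h \<in> ?S" for h
  proof -
    have h: "h \<in> borel_measurable N" and h1: "\<And>x. x \<in> space N \<Longrightarrow> \<bar>h x\<bar> \<le> 1"
      using that by (simp_all add: measurable_cong_sets[OF sP refl] spc)
    show "\<bar>\<integral>x. h x \<partial>P\<bar> \<le> 1" "\<bar>\<integral>x. h x \<partial>R\<bar> \<le> 1"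
      by (rule abs_integral_prob_le(1)[OF P h] abs_integral_prob_le(1)[OF R h], rule AE_I2, simp add: h1 spc)+
  qed
  have bdd: "bdd_above (?F ` ?S)"
    by (rule bdd_aboveI2[where M=2]) (use le1 in fastforce)
  obtain x0 where "x0 \<in> space N" using P.not_empty spc by auto
  then have B0: "0 \<le> B" using B[of x0] by linarith
  have "(\<lambda>x. g x / B) \<in> ?S"
    using g B B0 by (auto simp: measurable_cong_sets[OF sP refl] spc divide_le_eq_1)
  then have "?F (\<lambda>x. g x / B) \<le> tv_dist P R"
    unfolding tv_dist_def by (rule cSUP_upper[OF _ bdd])
  then have "B * ?F (\<lambda>x. g x / B) \<le> B * tv_dist P R" using B0 by (rule mult_left_mono)
  moreover have "B * ?F (\<lambda>x. g x / B) = ?F g"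
  proof (cases "B = 0")
    case True
    then have "(\<integral>x. g x \<partial>P) = 0" "(\<integral>x. g x \<partial>R) = 0"
      using B by (auto intro!: integral_eq_zero_AE AE_I2 simp: spc)
    then show ?thesis using True by simp
  next
    case False
    then have "B * ?F (\<lambda>x. g x / B) = \<bar>B * (((\<integral>x. g x \<partial>P) - (\<integral>x. g x \<partial>R)) / B)\<bar>"
      using B0 by (simp add: abs_mult diff_divide_distrib)
    then show ?thesis using False by simp
  qed
  ultimately show ?thesis by simp
qed

section \<open>History laws and marginals\<close>

text \<open>The conditions under which every policy determines a process law. Costs and constraint functions are
  treated alike, as measurable bounded functions passed to the criterion one at a time.\<close>

locale mdp =
  fixes M :: "('x, 'a, 'l) cmdp"
  assumes trans_kernel: "trans M \<in> pair_space M \<rightarrow>\<^sub>M prob_algebra (states M)"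
    and init_prob: "init M \<in> space (prob_algebra (states M))"
begin

text \<open>The law of a state-action pair when the state has law \<open>\<mu>\<close> and the action is then drawn from \<open>\<phi>\<close>.
  Every step of the process has this form.\<close>

definition action_step :: "('x \<Rightarrow> 'a measure) \<Rightarrow> 'x measure \<Rightarrow> ('x \<times> 'a) measure" where
  "action_step \<phi> \<mu> = \<mu> \<bind> (\<lambda>x. \<phi> x \<bind> (\<lambda>a. return (pair_space M) (x, a)))"

definition next_state :: "nat \<Rightarrow> (nat \<Rightarrow> 'x \<times> 'a) \<Rightarrow> 'x measure" where
  "next_state t h = (if t = 0 then init M else trans M (h (t - 1)))"

lemma step_kernel_eq: "step_kernel M \<pi> t h = action_step (\<lambda>x. \<pi> t (h, x)) (next_state t h)"
  by (simp add: step_kernel_def action_step_def next_state_def)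

lemma pair_return_kernel:
  "(\<lambda>(x, a). return (pair_space M) (x, a)) \<in> states M \<Otimes>\<^sub>M actions M \<rightarrow>\<^sub>M prob_algebra (pair_space M)"
  unfolding pair_space_def by simp

lemma action_kernel:
  assumes "\<phi> \<in> states M \<rightarrow>\<^sub>M prob_algebra (actions M)"
  shows "(\<lambda>x. \<phi> x \<bind> (\<lambda>a. return (pair_space M) (x, a))) \<in> states M \<rightarrow>\<^sub>M prob_algebra (pair_space M)"
  using assms pair_return_kernel by (rule measurable_bind_prob_space2)

lemma action_step_kernel:
  assumes "\<phi> \<in> states M \<rightarrow>\<^sub>M prob_algebra (actions M)"
  shows "action_step \<phi> \<in> prob_algebra (states M) \<rightarrow>\<^sub>M prob_algebra (pair_space M)"
  unfolding action_step_def[abs_def]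
  by (rule measurable_bind_prob_space[OF _ action_kernel[OF assms]]) simp

lemma nn_integral_action_step:
  assumes \<phi>: "\<phi> \<in> states M \<rightarrow>\<^sub>M prob_algebra (actions M)" and \<mu>: "sets \<mu> = sets (states M)"
    and g: "g \<in> borel_measurable (pair_space M)"
  shows "(\<integral>\<^sup>+z. g z \<partial>action_step \<phi> \<mu>) = (\<integral>\<^sup>+x. \<integral>\<^sup>+a. g (x, a) \<partial>\<phi> x \<partial>\<mu>)"
proof -
  have m: "(\<lambda>x. \<phi> x \<bind> (\<lambda>a. return (pair_space M) (x, a))) \<in> \<mu> \<rightarrow>\<^sub>M subprob_algebra (pair_space M)"
    using measurable_prob_algebraD[OF action_kernel[OF \<phi>]] by (simp add: measurable_cong_sets[OF \<mu> refl])
  have "(\<integral>\<^sup>+z. g z \<partial>(\<phi> x \<bind> (\<lambda>a. return (pair_space M) (x, a)))) = (\<integral>\<^sup>+a. g (x, a) \<partial>\<phi> x)"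
    if x: "x \<in> space (states M)" for x
  proof -
    have s: "sets (\<phi> x) = sets (actions M)"
      using measurable_space[OF \<phi> x] by (simp add: space_prob_algebra)
    have "(\<lambda>a. return (pair_space M) (x, a)) \<in> \<phi> x \<rightarrow>\<^sub>M subprob_algebra (pair_space M)"
      unfolding measurable_cong_sets[OF s refl] using x by (simp add: pair_space_def)
    then have "(\<integral>\<^sup>+z. g z \<partial>(\<phi> x \<bind> (\<lambda>a. return (pair_space M) (x, a)))) =
        (\<integral>\<^sup>+a. \<integral>\<^sup>+z. g z \<partial>return (pair_space M) (x, a) \<partial>\<phi> x)"
      by (rule nn_integral_bind[OF g])
    also have "\<dots> = (\<integral>\<^sup>+a. g (x, a) \<partial>\<phi> x)"
      using x sets_eq_imp_space_eq[OF s]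
      by (intro nn_integral_cong nn_integral_return g) (simp add: pair_space_def space_pair_measure)
    finally show ?thesis .
  qed
  then show ?thesis
    unfolding action_step_def
    by (subst nn_integral_bind[OF g m]) (auto intro!: nn_integral_cong simp: sets_eq_imp_space_eq[OF \<mu>])
qed

abbreviation hist_space :: "nat \<Rightarrow> (nat \<Rightarrow> 'x \<times> 'a) measure" where
  "hist_space t \<equiv> PiM {0..<t} (\<lambda>_. pair_space M)"

lemma next_state_kernel: "next_state t \<in> hist_space t \<rightarrow>\<^sub>M prob_algebra (states M)"
proof (cases "t = 0")
  case True
  then show ?thesis using init_prob by (simp add: next_state_def[abs_def])
next
  case False
  then have "(\<lambda>h. h (t - 1)) \<in> hist_space t \<rightarrow>\<^sub>M pair_space M"
    by (intro measurable_component_singleton) auto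
  from measurable_compose[OF this trans_kernel] False show ?thesis
    by (simp add: next_state_def[abs_def])
qed

lemma policy_kernel:
  assumes "\<pi> \<in> policies M"
  shows "\<pi> t \<in> hist_space t \<Otimes>\<^sub>M states M \<rightarrow>\<^sub>M prob_algebra (actions M)"
  using assms by (simp add: policies_def)

lemma policy_section:
  assumes "\<pi> \<in> policies M" "h \<in> space (hist_space t)"
  shows "(\<lambda>x. \<pi> t (h, x)) \<in> states M \<rightarrow>\<^sub>M prob_algebra (actions M)"
  using policy_kernel[OF assms(1)] assms(2) by simp

lemma step_kernel_measurable:
  assumes "\<pi> \<in> policies M"
  shows "step_kernel M \<pi> t \<in> hist_space t \<rightarrow>\<^sub>M prob_algebra (pair_space M)"
  unfolding step_kernel_def[abs_def] next_state_def[symmetric]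
proof (rule measurable_bind_prob_space2[OF next_state_kernel], unfold split_def,
    rule measurable_bind_prob_space2)
  show "(\<lambda>x. \<pi> t (fst x, snd x)) \<in> hist_space t \<Otimes>\<^sub>M states M \<rightarrow>\<^sub>M prob_algebra (actions M)"
    using policy_kernel[OF assms] by simp
  show "(\<lambda>(x, y). return (pair_space M) (snd x, y))
      \<in> (hist_space t \<Otimes>\<^sub>M states M) \<Otimes>\<^sub>M actions M \<rightarrow>\<^sub>M prob_algebra (pair_space M)"
    unfolding pair_space_def by simp
qed

lemma Ionescu_Tulcea_step_kernel:
  assumes "\<pi> \<in> policies M"
  shows "Ionescu_Tulcea (step_kernel M \<pi>) (\<lambda>_. pair_space M)"
proof (rule Ionescu_Tulcea.intro)
  show "step_kernel M \<pi> t \<in> hist_space t \<rightarrow>\<^sub>M subprob_algebra (pair_space M)" for t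
    by (rule measurable_prob_algebraD[OF step_kernel_measurable[OF assms]])
  show "h \<in> space (hist_space t) \<Longrightarrow> prob_space (step_kernel M \<pi> t h)" for t h
    using measurable_space[OF step_kernel_measurable[OF assms]] by (auto simp: space_prob_algebra)
qed

definition hist_law :: "(nat \<Rightarrow> (nat \<Rightarrow> 'x \<times> 'a) \<times> 'x \<Rightarrow> 'a measure) \<Rightarrow> nat \<Rightarrow> (nat \<Rightarrow> 'x \<times> 'a) measure" where
  "hist_law \<pi> t = Ionescu_Tulcea.C (step_kernel M \<pi>) (\<lambda>_. pair_space M) 0 t (\<lambda>_. undefined)"

definition marginal :: "(nat \<Rightarrow> (nat \<Rightarrow> 'x \<times> 'a) \<times> 'x \<Rightarrow> 'a measure) \<Rightarrow> nat \<Rightarrow> ('x \<times> 'a) measure" where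
  "marginal \<pi> t = distr (law M \<pi>) (pair_space M) (\<lambda>\<omega>. \<omega> t)"

context
  fixes \<pi> assumes \<pi>: "\<pi> \<in> policies M"
begin

interpretation IT: Ionescu_Tulcea "step_kernel M \<pi>" "\<lambda>_. pair_space M"
  by (rule Ionescu_Tulcea_step_kernel[OF \<pi>])

lemma hist_law_in_prob_algebra: "hist_law \<pi> t \<in> space (prob_algebra (hist_space t))"
  using IT.prob_space_C[of "\<lambda>_. undefined" 0 t] IT.sets_C[of "\<lambda>_. undefined" 0 t]
  by (simp add: hist_law_def space_prob_algebra)

text \<open>A history of length \<open>t + 1\<close> is one of length \<open>t\<close> prolonged by a pair drawn from \<open>step_kernel\<close>; this
  recursion is what inductions over time use in place of the infinite product space.\<close>

lemma nn_integral_hist_law_Suc: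
  assumes g: "g \<in> borel_measurable (hist_space (Suc t))"
  shows "(\<integral>\<^sup>+h. g h \<partial>hist_law \<pi> (Suc t)) =
    (\<integral>\<^sup>+h. \<integral>\<^sup>+z. g (h(t := z)) \<partial>step_kernel M \<pi> t h \<partial>hist_law \<pi> t)"
proof -
  have s: "sets (hist_law \<pi> t) = sets (hist_space t)"
    using hist_law_in_prob_algebra by (simp add: space_prob_algebra)
  have eP: "IT.eP t \<in> hist_law \<pi> t \<rightarrow>\<^sub>M subprob_algebra (hist_space (Suc t))"
    unfolding measurable_cong_sets[OF s refl] by (rule IT.measurable_eP)
  have "hist_law \<pi> (Suc t) = hist_law \<pi> t \<bind> IT.eP t"
    by (simp add: hist_law_def)
  then show ?thesis
    by (simp only: nn_integral_bind[OF g eP])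
       (auto intro!: nn_integral_cong IT.nn_integral_eP g simp: sets_eq_imp_space_eq[OF s])
qed

text \<open>A measure with a probability measure as image is a probability measure; the projection to the empty
  product is enough.\<close>

lemma prob_space_law: "prob_space (law M \<pi>)"
proof -
  have "distr (law M \<pi>) (PiM {} (\<lambda>_. pair_space M)) (\<lambda>\<omega>. restrict \<omega> {}) = IT.CI {}"
    unfolding law_def by (rule IT.distr_lim) (rule finite.emptyI)
  moreover have "prob_space (IT.CI {})" by (rule IT.PF.prob_space_P) simp_all
  moreover have "(\<lambda>\<omega>. restrict \<omega> {}) \<in> law M \<pi> \<rightarrow>\<^sub>M PiM {} (\<lambda>_. pair_space M)"
    unfolding law_def measurable_cong_sets[OF IT.PF.sets_lim refl]
    by (rule measurable_restrict_subset) (rule empty_subsetI)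
  ultimately show ?thesis by (metis prob_space_distrD)
qed

lemma sets_law: "sets (law M \<pi>) = sets (PiM UNIV (\<lambda>_. pair_space M))"
  unfolding law_def by (rule IT.PF.sets_lim)

lemma coordinate_measurable: "(\<lambda>\<omega>. \<omega> t) \<in> law M \<pi> \<rightarrow>\<^sub>M pair_space M"
  unfolding measurable_cong_sets[OF sets_law refl] by (rule measurable_component_singleton) simp

lemma marginal_in_prob_algebra: "marginal \<pi> t \<in> space (prob_algebra (pair_space M))"
  unfolding marginal_def
  using prob_space.prob_space_distr[OF prob_space_law coordinate_measurable]
  by (simp add: space_prob_algebra)

text \<open>The coordinate at time \<open>t\<close> depends only on the first \<open>t + 1\<close> coordinates, on which the projective
  limit agrees with the law of finite histories.\<close>

lemma marginal_eq_last: "marginal \<pi> t = distr (hist_law \<pi> (Suc t)) (pair_space M) (\<lambda>h. h t)"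
proof -
  let ?J = "{0..<Suc t}"
  have up: "IT.up_to ?J = Suc t"
    unfolding IT.up_to_def by (rule Least_equality) (auto simp: not_less_eq_eq)
  have s: "sets (hist_law \<pi> (Suc t)) = sets (hist_space (Suc t))"
    using hist_law_in_prob_algebra by (simp add: space_prob_algebra)
  have ct: "(\<lambda>h. h t) \<in> hist_space (Suc t) \<rightarrow>\<^sub>M pair_space M"
    by (intro measurable_component_singleton) auto
  have rs: "(\<lambda>\<omega>. restrict \<omega> ?J) \<in> law M \<pi> \<rightarrow>\<^sub>M hist_space (Suc t)"
    unfolding measurable_cong_sets[OF sets_law refl] by (rule measurable_restrict_subset) (rule subset_UNIV)
  have "marginal \<pi> t = distr (distr (law M \<pi>) (hist_space (Suc t)) (\<lambda>\<omega>. restrict \<omega> ?J)) (pair_space M) (\<lambda>h. h t)"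
    unfolding marginal_def by (subst distr_distr[OF ct rs]) (simp add: comp_def)
  also have "distr (law M \<pi>) (hist_space (Suc t)) (\<lambda>\<omega>. restrict \<omega> ?J) = IT.CI ?J"
    unfolding law_def by (rule IT.distr_lim) simp
  also have "\<dots> = distr (hist_law \<pi> (Suc t)) (hist_space (Suc t)) (\<lambda>h. restrict h ?J)"
    unfolding IT.CI_def up hist_law_def ..
  also have "\<dots> = distr (hist_law \<pi> (Suc t)) (hist_space (Suc t)) (\<lambda>h. h)"
    by (rule distr_cong) (auto simp: sets_eq_imp_space_eq[OF s] space_PiM PiE_restrict)
  also have "\<dots> = hist_law \<pi> (Suc t)"
    by (rule distr_id2) (rule s[symmetric])
  finally show ?thesis .
qed

lemma nn_integral_marginal:
  assumes g: "g \<in> borel_measurable (pair_space M)"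
  shows "(\<integral>\<^sup>+z. g z \<partial>marginal \<pi> t) = (\<integral>\<^sup>+h. \<integral>\<^sup>+z. g z \<partial>step_kernel M \<pi> t h \<partial>hist_law \<pi> t)"
proof -
  have ct: "(\<lambda>h. h t) \<in> hist_space (Suc t) \<rightarrow>\<^sub>M pair_space M"
    by (intro measurable_component_singleton) auto
  have s: "sets (hist_law \<pi> (Suc t)) = sets (hist_space (Suc t))"
    using hist_law_in_prob_algebra by (simp add: space_prob_algebra)
  have "(\<integral>\<^sup>+z. g z \<partial>marginal \<pi> t) = (\<integral>\<^sup>+h. g (h t) \<partial>hist_law \<pi> (Suc t))"
    unfolding marginal_eq_last by (subst nn_integral_distr) (use ct g in \<open>auto simp: measurable_cong_sets[OF s refl]\<close>)
  also have "\<dots> = (\<integral>\<^sup>+h. \<integral>\<^sup>+z. g z \<partial>step_kernel M \<pi> t h \<partial>hist_law \<pi> t)"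
    by (subst nn_integral_hist_law_Suc) (use measurable_compose[OF ct g] in auto)
  finally show ?thesis .
qed

text \<open>By dominated convergence the criterion depends on the policy only through the laws of the pairs at
  the individual times. All comparisons of criteria below are comparisons of these marginals.\<close>

lemma disc_eq_suminf_marginal:
  fixes f :: "'x \<times> 'a \<Rightarrow> real"
  assumes \<beta>: "0 < \<beta>" "\<beta> < 1"
    and f: "f \<in> borel_measurable (pair_space M)"
    and B: "\<And>z. z \<in> space (pair_space M) \<Longrightarrow> \<bar>f z\<bar> \<le> B"
  shows "disc \<beta> M f \<pi> = (1 - \<beta>) * (\<Sum>t. \<beta> ^ t * (\<integral>z. f z \<partial>marginal \<pi> t))"
proof -
  interpret L: prob_space "law M \<pi>" by (rule prob_space_law)
  have fm: "(\<lambda>\<omega>. f (\<omega> t)) \<in> borel_measurable (law M \<pi>)" for t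
    by (rule measurable_compose[OF coordinate_measurable f])
  have bd: "\<bar>f (\<omega> t)\<bar> \<le> B" if "\<omega> \<in> space (law M \<pi>)" for \<omega> t
    by (rule B[OF measurable_space[OF coordinate_measurable that]])
  have i: "integrable (law M \<pi>) (\<lambda>\<omega>. f (\<omega> t))" for t
    by (rule L.integrable_const_bound[where B=B]) (auto simp: bd fm)
  have sB: "summable (\<lambda>t. \<beta> ^ t * B)"
    using \<beta> by (intro summable_mult2 summable_geometric) auto
  have 1: "(\<integral>\<omega>. (\<Sum>t. \<beta> ^ t * f (\<omega> t)) \<partial>law M \<pi>) = (\<Sum>t. \<integral>\<omega>. \<beta> ^ t * f (\<omega> t) \<partial>law M \<pi>)"
  proof (rule integral_suminf)
    show "integrable (law M \<pi>) (\<lambda>\<omega>. \<beta> ^ t * f (\<omega> t))" for t using i by simp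
    show "AE \<omega> in law M \<pi>. summable (\<lambda>t. norm (\<beta> ^ t * f (\<omega> t)))"
      using \<beta> bd by (intro AE_I2 summable_comparison_test'[OF sB, of 0])
        (auto simp: abs_mult intro!: mult_left_mono)
    have "(\<integral>\<omega>. norm (\<beta> ^ t * f (\<omega> t)) \<partial>law M \<pi>) \<le> \<beta> ^ t * B" for t
    proof -
      have "(\<integral>\<omega>. norm (\<beta> ^ t * f (\<omega> t)) \<partial>law M \<pi>) \<le> (\<integral>\<omega>. \<beta> ^ t * B \<partial>law M \<pi>)"
        using \<beta> i by (intro integral_mono) (auto simp: abs_mult bd intro!: mult_left_mono)
      then show ?thesis by (simp add: L.prob_space)
    qed
    then show "summable (\<lambda>t. \<integral>\<omega>. norm (\<beta> ^ t * f (\<omega> t)) \<partial>law M \<pi>)"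
      by (intro summable_comparison_test'[OF sB, of 0]) auto
  qed
  have 2: "(\<integral>\<omega>. \<beta> ^ t * f (\<omega> t) \<partial>law M \<pi>) = \<beta> ^ t * (\<integral>z. f z \<partial>marginal \<pi> t)" for t
    unfolding marginal_def by (simp add: integral_distr[OF coordinate_measurable f])
  show ?thesis unfolding disc_def 1 2 ..
qed

lemma abs_integral_marginal_le:
  fixes f :: "'x \<times> 'a \<Rightarrow> real"
  assumes f: "f \<in> borel_measurable (pair_space M)" "\<And>z. z \<in> space (pair_space M) \<Longrightarrow> \<bar>f z\<bar> \<le> B"
  shows "\<bar>\<integral>z. f z \<partial>marginal \<pi> t\<bar> \<le> B"
proof (rule abs_integral_prob_le(1)[OF marginal_in_prob_algebra f(1)])
  have "space (marginal \<pi> t) = space (pair_space M)"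
    using marginal_in_prob_algebra by (auto simp: space_prob_algebra dest: sets_eq_imp_space_eq)
  then show "AE z in marginal \<pi> t. \<bar>f z\<bar> \<le> B" by (intro AE_I2 f(2)) simp
qed

end

lemma summable_discounted:
  fixes f :: "'x \<times> 'a \<Rightarrow> real"
  assumes "\<pi> \<in> policies M" "0 < \<beta>" "\<beta> < 1"
    and "f \<in> borel_measurable (pair_space M)" "\<And>z. z \<in> space (pair_space M) \<Longrightarrow> \<bar>f z\<bar> \<le> B"
  shows "summable (\<lambda>t. \<beta> ^ t * (\<integral>z. f z \<partial>marginal \<pi> t))"
proof (rule summable_comparison_test'[where N=0])
  show "summable (\<lambda>t. \<beta> ^ t * B)"
    using assms by (intro summable_mult2 summable_geometric) auto
  show "norm (\<beta> ^ t * (\<integral>z. f z \<partial>marginal \<pi> t)) \<le> \<beta> ^ t * B" for t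
    using assms abs_integral_marginal_le[of \<pi> f B t] by (simp add: abs_mult mult_left_mono)
qed

lemma disc_le:
  fixes f :: "'x \<times> 'a \<Rightarrow> real"
  assumes \<pi>: "\<pi> \<in> policies M" and \<beta>: "0 < \<beta>" "\<beta> < 1"
    and f: "f \<in> borel_measurable (pair_space M)" "\<And>z. z \<in> space (pair_space M) \<Longrightarrow> \<bar>f z\<bar> \<le> B"
  shows "disc \<beta> M f \<pi> \<le> B"
proof -
  have "(\<Sum>t. \<beta> ^ t * (\<integral>z. f z \<partial>marginal \<pi> t)) \<le> (\<Sum>t. \<beta> ^ t * B)"
  proof (rule suminf_le)
    fix t
    have "(\<integral>z. f z \<partial>marginal \<pi> t) \<le> B"
      using abs_integral_marginal_le[OF \<pi> f, of t] by linarith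
    then show "\<beta> ^ t * (\<integral>z. f z \<partial>marginal \<pi> t) \<le> \<beta> ^ t * B"
      using \<beta> by (intro mult_left_mono) auto
    show "summable (\<lambda>t. \<beta> ^ t * (\<integral>z. f z \<partial>marginal \<pi> t))" by (rule summable_discounted[OF \<pi> \<beta> f])
    show "summable (\<lambda>t. \<beta> ^ t * B)" using \<beta> by (intro summable_mult2 summable_geometric) auto
  qed
  also have "\<dots> = B / (1 - \<beta>)"
    using \<beta> by (simp add: suminf_mult2[symmetric] suminf_geometric)
  finally have "(1 - \<beta>) * (\<Sum>t. \<beta> ^ t * (\<integral>z. f z \<partial>marginal \<pi> t)) \<le> (1 - \<beta>) * (B / (1 - \<beta>))"
    using \<beta> by (intro mult_left_mono) auto
  then show ?thesis using \<beta> disc_eq_suminf_marginal[OF \<pi> \<beta> f] by simp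
qed

lemma disc_nonneg:
  fixes f :: "'x \<times> 'a \<Rightarrow> real"
  assumes \<pi>: "\<pi> \<in> policies M" and \<beta>: "0 < \<beta>" "\<beta> < 1"
    and f: "f \<in> borel_measurable (pair_space M)" "\<And>z. z \<in> space (pair_space M) \<Longrightarrow> \<bar>f z\<bar> \<le> B"
    and pos: "\<And>z. z \<in> space (pair_space M) \<Longrightarrow> 0 \<le> f z"
  shows "0 \<le> disc \<beta> M f \<pi>"
proof -
  have "space (marginal \<pi> t) = space (pair_space M)" for t
    using marginal_in_prob_algebra[OF \<pi>] by (auto simp: space_prob_algebra dest: sets_eq_imp_space_eq)
  then have "0 \<le> (\<integral>z. f z \<partial>marginal \<pi> t)" for t
    using pos by (intro integral_nonneg_AE AE_I2) auto
  then have "0 \<le> (1 - \<beta>) * (\<Sum>t. \<beta> ^ t * (\<integral>z. f z \<partial>marginal \<pi> t))"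
    using \<beta> by (intro mult_nonneg_nonneg suminf_nonneg summable_discounted[OF \<pi> \<beta> f]) auto
  then show ?thesis using disc_eq_suminf_marginal[OF \<pi> \<beta> f] by simp
qed

section \<open>Mixing two policies\<close>

text \<open>The history laws \<open>H\<^sub>1\<close>, \<open>H\<^sub>2\<close> of the two policies at time \<open>t\<close> give posterior weights \<open>w t\<close>, and the
  new policy draws from \<open>\<pi>1\<close> with probability \<open>w t h\<close> and from \<open>\<pi>2\<close> otherwise. If its own history law is
  \<open>D = r H\<^sub>1 + (1 - r) H\<^sub>2\<close>, then prolonging the history by one step gives
  \<open>w D\<close> prolonged under \<open>\<pi>1\<close> plus \<open>(1 - w) D\<close> prolonged under \<open>\<pi>2\<close>, and \<open>w D = r H\<^sub>1\<close>,
  \<open>(1 - w) D = (1 - r) H\<^sub>2\<close>. Hence the mixture persists from each time to the next. The weights may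
  ignore the current state because its law given the history is the same for both policies.\<close>

lemma mixed_policy:
  assumes \<pi>1: "\<pi>1 \<in> policies M" and \<pi>2: "\<pi>2 \<in> policies M" and r: "0 \<le> r" "r \<le> 1"
  obtains \<pi> where "\<pi> \<in> policies M"
    "\<And>t. marginal \<pi> t = mixture r (marginal \<pi>1 t) (marginal \<pi>2 t)"
proof -
  note H = hist_law_in_prob_algebra[OF \<pi>1] hist_law_in_prob_algebra[OF \<pi>2]
  have "\<forall>t. \<exists>w. w \<in> borel_measurable (hist_space t) \<and> (\<forall>h. 0 \<le> w h) \<and> (\<forall>h. w h \<le> 1) \<and>
    (\<forall>g\<in>borel_measurable (hist_space t).
      (\<integral>\<^sup>+h. ennreal (w h) * g h \<partial>mixture r (hist_law \<pi>1 t) (hist_law \<pi>2 t)) =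
        ennreal r * (\<integral>\<^sup>+h. g h \<partial>hist_law \<pi>1 t) \<and>
      (\<integral>\<^sup>+h. ennreal (1 - w h) * g h \<partial>mixture r (hist_law \<pi>1 t) (hist_law \<pi>2 t)) =
        ennreal (1 - r) * (\<integral>\<^sup>+h. g h \<partial>hist_law \<pi>2 t))"
    (is "\<forall>t. \<exists>w. ?W t w")
  proof
    fix t
    show "\<exists>w. ?W t w"
      by (rule mixture_posterior[OF H[of t] r]) blast
  qed
  from choice[OF this] obtain w where W: "\<And>t. ?W t (w t)" by blast
  have w: "w t \<in> borel_measurable (hist_space t)" "0 \<le> w t h" "w t h \<le> 1" for t h
    using W[of t] by simp_all
  have w': "(\<integral>\<^sup>+h. ennreal (w t h) * g h \<partial>mixture r (hist_law \<pi>1 t) (hist_law \<pi>2 t)) =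
        ennreal r * (\<integral>\<^sup>+h. g h \<partial>hist_law \<pi>1 t)"
    "(\<integral>\<^sup>+h. ennreal (1 - w t h) * g h \<partial>mixture r (hist_law \<pi>1 t) (hist_law \<pi>2 t)) =
        ennreal (1 - r) * (\<integral>\<^sup>+h. g h \<partial>hist_law \<pi>2 t)"
    if "g \<in> borel_measurable (hist_space t)" for t g
    using W[of t] that by simp_all
  define \<pi> where "\<pi> t = (\<lambda>y. mixture (w t (fst y)) (\<pi>1 t y) (\<pi>2 t y))" for t
  have \<pi>: "\<pi> \<in> policies M"
    unfolding policies_def \<pi>_def mem_Collect_eq
    by (intro allI mixture_kernel_measurable policy_kernel[OF \<pi>1] policy_kernel[OF \<pi>2]
        measurable_compose[OF measurable_fst w(1)]) (simp add: w)
  have step: "(\<integral>\<^sup>+z. g z \<partial>step_kernel M \<pi> t h) =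
      ennreal (w t h) * (\<integral>\<^sup>+z. g z \<partial>step_kernel M \<pi>1 t h) +
      ennreal (1 - w t h) * (\<integral>\<^sup>+z. g z \<partial>step_kernel M \<pi>2 t h)"
    if h: "h \<in> space (hist_space t)" and g: "g \<in> borel_measurable (pair_space M)" for t h g
  proof -
    let ?I = "\<lambda>\<pi>' x. \<integral>\<^sup>+a. g (x, a) \<partial>\<pi>' t (h, x)"
    have s: "sets (next_state t h) = sets (states M)"
      using measurable_space[OF next_state_kernel h] by (simp add: space_prob_algebra)
    have nn: "(\<integral>\<^sup>+z. g z \<partial>step_kernel M \<pi>' t h) = (\<integral>\<^sup>+x. ?I \<pi>' x \<partial>next_state t h)"
      if "\<pi>' \<in> policies M" for \<pi>'
      unfolding step_kernel_eq by (rule nn_integral_action_step[OF policy_section[OF that h] s g])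
    have m: "?I \<pi>' \<in> borel_measurable (next_state t h)" if "\<pi>' \<in> policies M" for \<pi>'
      unfolding measurable_cong_sets[OF s refl]
      by (rule nn_integral_measurable_subprob_algebra2[where N="actions M"])
        (use g measurable_prob_algebraD[OF policy_section[OF that h]] in \<open>simp_all add: pair_space_def\<close>)
    have "(\<integral>\<^sup>+z. g z \<partial>step_kernel M \<pi> t h) =
      (\<integral>\<^sup>+x. ennreal (w t h) * ?I \<pi>1 x + ennreal (1 - w t h) * ?I \<pi>2 x \<partial>next_state t h)"
      unfolding nn[OF \<pi>]
    proof (rule nn_integral_cong)
      fix x assume "x \<in> space (next_state t h)"
      then have x: "x \<in> space (states M)" by (simp add: sets_eq_imp_space_eq[OF s])
      have "(\<lambda>a. g (x, a)) \<in> borel_measurable (actions M)"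
        using x g by (simp add: pair_space_def)
      then show "?I \<pi> x = ennreal (w t h) * ?I \<pi>1 x + ennreal (1 - w t h) * ?I \<pi>2 x"
        using measurable_space[OF policy_section[OF \<pi>1 h] x] measurable_space[OF policy_section[OF \<pi>2 h] x]
        unfolding \<pi>_def fst_conv by (intro nn_integral_mixture w(2,3))
    qed
    also have "\<dots> = ennreal (w t h) * (\<integral>\<^sup>+x. ?I \<pi>1 x \<partial>next_state t h) +
        ennreal (1 - w t h) * (\<integral>\<^sup>+x. ?I \<pi>2 x \<partial>next_state t h)"
      using m[OF \<pi>1] m[OF \<pi>2] by (simp add: nn_integral_add nn_integral_cmult)
    finally show ?thesis unfolding nn[OF \<pi>1] nn[OF \<pi>2] .
  qed
  have inner: "(\<lambda>h. \<integral>\<^sup>+z. g h z \<partial>step_kernel M \<pi>' t h) \<in> borel_measurable (hist_space t)"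
    if "\<pi>' \<in> policies M" and "(\<lambda>(h, z). g h z) \<in> borel_measurable (hist_space t \<Otimes>\<^sub>M pair_space M)" for \<pi>' t g
    by (rule nn_integral_measurable_subprob_algebra2[OF that(2)
          measurable_prob_algebraD[OF step_kernel_measurable[OF that(1)]]])
  \<comment> \<open>The inductive step in a form that also serves for the marginals: \<open>g\<close> may depend on the history
    and on the new pair.\<close>
  have outer: "(\<integral>\<^sup>+h. \<integral>\<^sup>+z. g h z \<partial>step_kernel M \<pi> t h \<partial>hist_law \<pi> t) =
      ennreal r * (\<integral>\<^sup>+h. \<integral>\<^sup>+z. g h z \<partial>step_kernel M \<pi>1 t h \<partial>hist_law \<pi>1 t) +
      ennreal (1 - r) * (\<integral>\<^sup>+h. \<integral>\<^sup>+z. g h z \<partial>step_kernel M \<pi>2 t h \<partial>hist_law \<pi>2 t)"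
    if eq: "hist_law \<pi> t = mixture r (hist_law \<pi>1 t) (hist_law \<pi>2 t)"
      and g: "(\<lambda>(h, z). g h z) \<in> borel_measurable (hist_space t \<Otimes>\<^sub>M pair_space M)" for t g
  proof -
    have s: "sets (hist_law \<pi> t) = sets (hist_space t)"
      using hist_law_in_prob_algebra[OF \<pi>] by (simp add: space_prob_algebra)
    have "(\<integral>\<^sup>+h. \<integral>\<^sup>+z. g h z \<partial>step_kernel M \<pi> t h \<partial>hist_law \<pi> t) =
      (\<integral>\<^sup>+h. ennreal (w t h) * (\<integral>\<^sup>+z. g h z \<partial>step_kernel M \<pi>1 t h) +
        ennreal (1 - w t h) * (\<integral>\<^sup>+z. g h z \<partial>step_kernel M \<pi>2 t h) \<partial>hist_law \<pi> t)"
      using g by (intro nn_integral_cong step) (auto simp: sets_eq_imp_space_eq[OF s])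
    also have "\<dots> = (\<integral>\<^sup>+h. ennreal (w t h) * (\<integral>\<^sup>+z. g h z \<partial>step_kernel M \<pi>1 t h) \<partial>hist_law \<pi> t) +
        (\<integral>\<^sup>+h. ennreal (1 - w t h) * (\<integral>\<^sup>+z. g h z \<partial>step_kernel M \<pi>2 t h) \<partial>hist_law \<pi> t)"
      using inner[OF \<pi>1 g] inner[OF \<pi>2 g] w(1)[of t]
      by (intro nn_integral_add) (simp_all add: measurable_cong_sets[OF s refl])
    also have "\<dots> = ennreal r * (\<integral>\<^sup>+h. \<integral>\<^sup>+z. g h z \<partial>step_kernel M \<pi>1 t h \<partial>hist_law \<pi>1 t) +
      ennreal (1 - r) * (\<integral>\<^sup>+h. \<integral>\<^sup>+z. g h z \<partial>step_kernel M \<pi>2 t h \<partial>hist_law \<pi>2 t)"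
      unfolding eq by (simp only: w'(1)[OF inner[OF \<pi>1 g]] w'(2)[OF inner[OF \<pi>2 g]])
    finally show ?thesis .
  qed
  have hist: "hist_law \<pi> t = mixture r (hist_law \<pi>1 t) (hist_law \<pi>2 t)" for t
  proof (induction t)
    case 0
    have 1: "hist_law \<pi>' 0 = return (hist_space 0) (\<lambda>_. undefined)" if "\<pi>' \<in> policies M" for \<pi>'
      using Ionescu_Tulcea.C.simps(1)[OF Ionescu_Tulcea_step_kernel[OF that]]
      by (simp add: hist_law_def)
    show ?case
    proof (rule prob_algebra_eqI[OF hist_law_in_prob_algebra[OF \<pi>] mixture_in_prob_algebra[OF H]])
      fix g :: "(nat \<Rightarrow> 'x \<times> 'a) \<Rightarrow> ennreal" assume "g \<in> borel_measurable (hist_space 0)"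
      moreover have "ennreal r * a + ennreal (1 - r) * a = a" for a
        using r by (simp add: distrib_right[symmetric] ennreal_plus[symmetric] del: ennreal_plus)
      ultimately show "(\<integral>\<^sup>+h. g h \<partial>hist_law \<pi> 0) = (\<integral>\<^sup>+h. g h \<partial>mixture r (hist_law \<pi>1 0) (hist_law \<pi>2 0))"
        by (subst nn_integral_mixture[OF H r]) (simp_all only: 1[OF \<pi>] 1[OF \<pi>1] 1[OF \<pi>2])
    qed
  next
    case (Suc t)
    show ?case
    proof (rule prob_algebra_eqI[OF hist_law_in_prob_algebra[OF \<pi>] mixture_in_prob_algebra[OF H]])
      fix g :: "(nat \<Rightarrow> 'x \<times> 'a) \<Rightarrow> ennreal" assume g: "g \<in> borel_measurable (hist_space (Suc t))"
      have "(\<lambda>p. (fst p)(t := snd p)) \<in> hist_space t \<Otimes>\<^sub>M pair_space M \<rightarrow>\<^sub>M hist_space (Suc t)"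
        by (rule measurable_fun_upd[where J="{0..<t}"]) auto
      from measurable_compose[OF this g]
      have "(\<lambda>(h, z). g (h(t := z))) \<in> borel_measurable (hist_space t \<Otimes>\<^sub>M pair_space M)"
        by (simp add: split_def)
      from outer[OF Suc this]
      show "(\<integral>\<^sup>+h. g h \<partial>hist_law \<pi> (Suc t)) = (\<integral>\<^sup>+h. g h \<partial>mixture r (hist_law \<pi>1 (Suc t)) (hist_law \<pi>2 (Suc t)))"
        by (simp only: nn_integral_mixture[OF H r g] nn_integral_hist_law_Suc[OF \<pi> g]
            nn_integral_hist_law_Suc[OF \<pi>1 g] nn_integral_hist_law_Suc[OF \<pi>2 g])
    qed
  qed
  note Mg = marginal_in_prob_algebra[OF \<pi>1] marginal_in_prob_algebra[OF \<pi>2]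
  have "marginal \<pi> t = mixture r (marginal \<pi>1 t) (marginal \<pi>2 t)" for t
  proof (rule prob_algebra_eqI[OF marginal_in_prob_algebra[OF \<pi>] mixture_in_prob_algebra[OF Mg]])
    fix g :: "'x \<times> 'a \<Rightarrow> ennreal" assume g: "g \<in> borel_measurable (pair_space M)"
    then have "(\<lambda>(h, z). g z) \<in> borel_measurable (hist_space t \<Otimes>\<^sub>M pair_space M)" by simp
    from outer[OF hist this]
    show "(\<integral>\<^sup>+z. g z \<partial>marginal \<pi> t) = (\<integral>\<^sup>+z. g z \<partial>mixture r (marginal \<pi>1 t) (marginal \<pi>2 t))"
      by (simp only: nn_integral_mixture[OF Mg r g] nn_integral_marginal[OF \<pi> g]
            nn_integral_marginal[OF \<pi>1 g] nn_integral_marginal[OF \<pi>2 g])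
  qed
  with \<pi> that show ?thesis by blast
qed

lemma disc_mixed:
  fixes f :: "'x \<times> 'a \<Rightarrow> real"
  assumes \<pi>: "\<pi> \<in> policies M" and \<pi>1: "\<pi>1 \<in> policies M" and \<pi>2: "\<pi>2 \<in> policies M" and r: "0 \<le> r" "r \<le> 1"
    and eq: "\<And>t. marginal \<pi> t = mixture r (marginal \<pi>1 t) (marginal \<pi>2 t)"
    and \<beta>: "0 < \<beta>" "\<beta> < 1"
    and f: "f \<in> borel_measurable (pair_space M)" "\<And>z. z \<in> space (pair_space M) \<Longrightarrow> \<bar>f z\<bar> \<le> B"
  shows "disc \<beta> M f \<pi> = r * disc \<beta> M f \<pi>1 + (1 - r) * disc \<beta> M f \<pi>2"
proof -
  let ?m = "\<lambda>\<pi> t. \<integral>z. f z \<partial>marginal \<pi> t"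
  note s1 = summable_discounted[OF \<pi>1 \<beta> f] and s2 = summable_discounted[OF \<pi>2 \<beta> f]
  have "(\<Sum>t. \<beta> ^ t * ?m \<pi> t) = (\<Sum>t. r * (\<beta> ^ t * ?m \<pi>1 t) + (1 - r) * (\<beta> ^ t * ?m \<pi>2 t))"
    by (simp only: eq integral_mixture[OF marginal_in_prob_algebra[OF \<pi>1] marginal_in_prob_algebra[OF \<pi>2] r f])
      (simp add: algebra_simps)
  also have "\<dots> = r * (\<Sum>t. \<beta> ^ t * ?m \<pi>1 t) + (1 - r) * (\<Sum>t. \<beta> ^ t * ?m \<pi>2 t)"
    using s1 s2 by (simp add: suminf_add[symmetric] suminf_mult summable_mult)
  finally have S: "(\<Sum>t. \<beta> ^ t * ?m \<pi> t) =
      r * (\<Sum>t. \<beta> ^ t * ?m \<pi>1 t) + (1 - r) * (\<Sum>t. \<beta> ^ t * ?m \<pi>2 t)" .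
  have D: "disc \<beta> M f \<pi>' = (1 - \<beta>) * (\<Sum>t. \<beta> ^ t * ?m \<pi>' t)" if "\<pi>' \<in> policies M" for \<pi>'
    using that \<beta> f by (rule disc_eq_suminf_marginal)
  have "disc \<beta> M f \<pi> = (1 - \<beta>) * (r * (\<Sum>t. \<beta> ^ t * ?m \<pi>1 t) + (1 - r) * (\<Sum>t. \<beta> ^ t * ?m \<pi>2 t))"
    unfolding S[symmetric] by (rule D[OF \<pi>])
  also have "\<dots> = r * disc \<beta> M f \<pi>1 + (1 - r) * disc \<beta> M f \<pi>2"
    unfolding D[OF \<pi>1] D[OF \<pi>2] by (rule distrib_left[THEN trans]) (simp only: mult.left_commute)
  finally show ?thesis .
qed

section \<open>Stationary policies as Markov chains\<close>

lemma stationary_policy_apply [simp]: "stationary_policy \<phi> t (h, x) = \<phi> x"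
  by (simp add: stationary_policy_def)

lemma stationary_policy_in_policies:
  assumes "\<phi> \<in> stationary_kernels M"
  shows "stationary_policy \<phi> \<in> policies M"
  using assms unfolding policies_def stationary_policy_def stationary_kernels_def split_def
  by (auto intro: measurable_compose[OF measurable_snd])

lemma nn_integral_stationary_marginal_0:
  assumes \<phi>: "\<phi> \<in> stationary_kernels M" and g: "g \<in> borel_measurable (pair_space M)"
  shows "(\<integral>\<^sup>+z. g z \<partial>marginal (stationary_policy \<phi>) 0) = (\<integral>\<^sup>+z. g z \<partial>action_step \<phi> (init M))"
proof -
  note p = stationary_policy_in_policies[OF \<phi>]
  have "prob_space (hist_law (stationary_policy \<phi>) 0)"
    using hist_law_in_prob_algebra[OF p] by (auto simp: space_prob_algebra)
  then show ?thesis
    by (simp add: nn_integral_marginal[OF p g] step_kernel_eq next_state_def stationary_policy_apply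
        prob_space.emeasure_space_1)
qed

lemma stationary_step_kernel:
  assumes "\<phi> \<in> stationary_kernels M"
  shows "(\<lambda>z. action_step \<phi> (trans M z)) \<in> pair_space M \<rightarrow>\<^sub>M prob_algebra (pair_space M)"
  using assms unfolding stationary_kernels_def
  by (intro measurable_compose[OF trans_kernel action_step_kernel])

text \<open>Under a stationary policy the conditional law of the next pair depends on the history only through
  the last pair, so the marginals evolve by iteration of one kernel.\<close>

lemma stationary_marginal_Suc:
  assumes \<phi>: "\<phi> \<in> stationary_kernels M"
  shows "marginal (stationary_policy \<phi>) (Suc t) =
    marginal (stationary_policy \<phi>) t \<bind> (\<lambda>z. action_step \<phi> (trans M z))"
proof -
  let ?\<pi> = "stationary_policy \<phi>" and ?K = "\<lambda>z. action_step \<phi> (trans M z)"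
  note p = stationary_policy_in_policies[OF \<phi>]
  note K = stationary_step_kernel[OF \<phi>]
  have s: "sets (hist_law ?\<pi> (Suc t)) = sets (hist_space (Suc t))"
    using hist_law_in_prob_algebra[OF p] by (simp add: space_prob_algebra)
  have sm: "sets (marginal ?\<pi> t) = sets (pair_space M)"
    using marginal_in_prob_algebra[OF p] by (simp add: space_prob_algebra)
  have ct: "(\<lambda>h. h t) \<in> hist_law ?\<pi> (Suc t) \<rightarrow>\<^sub>M pair_space M"
    unfolding measurable_cong_sets[OF s refl] by (intro measurable_component_singleton) auto
  show ?thesis
  proof (rule prob_algebra_eqI[OF marginal_in_prob_algebra[OF p]])
    show "marginal ?\<pi> t \<bind> ?K \<in> space (prob_algebra (pair_space M))"
      using measurable_bind_prob_space[OF measurable_const[OF marginal_in_prob_algebra[OF p]] K,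
        THEN measurable_space, of undefined "count_space UNIV"] by simp
    fix g :: "'x \<times> 'a \<Rightarrow> ennreal" assume g: "g \<in> borel_measurable (pair_space M)"
    have Kg: "(\<lambda>z. \<integral>\<^sup>+y. g y \<partial>?K z) \<in> borel_measurable (pair_space M)"
      by (rule measurable_compose[OF measurable_prob_algebraD[OF K] nn_integral_measurable_subprob_algebra[OF g]])
    have "(\<integral>\<^sup>+z. g z \<partial>marginal ?\<pi> (Suc t)) = (\<integral>\<^sup>+h. \<integral>\<^sup>+z. g z \<partial>?K (h t) \<partial>hist_law ?\<pi> (Suc t))"
      by (simp add: nn_integral_marginal[OF p g] step_kernel_eq next_state_def stationary_policy_apply)
    also have "\<dots> = (\<integral>\<^sup>+z. \<integral>\<^sup>+y. g y \<partial>?K z \<partial>marginal ?\<pi> t)"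
      unfolding marginal_eq_last[OF p] by (rule nn_integral_distr[OF ct, symmetric]) (use Kg in simp)
    also have "\<dots> = (\<integral>\<^sup>+z. g z \<partial>(marginal ?\<pi> t \<bind> ?K))"
      by (rule nn_integral_bind[OF g, symmetric])
        (simp add: measurable_cong_sets[OF sm refl] measurable_prob_algebraD[OF K])
    finally show "(\<integral>\<^sup>+z. g z \<partial>marginal ?\<pi> (Suc t)) = (\<integral>\<^sup>+z. g z \<partial>(marginal ?\<pi> t \<bind> ?K))" .
  qed
qed

lemma integral_action_step:
  fixes f :: "'x \<times> 'a \<Rightarrow> real"
  assumes \<phi>: "\<phi> \<in> stationary_kernels M" and \<mu>: "\<mu> \<in> space (prob_algebra (states M))"
    and f: "f \<in> borel_measurable (pair_space M)" and B: "\<And>z. z \<in> space (pair_space M) \<Longrightarrow> \<bar>f z\<bar> \<le> B"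
  shows "(\<integral>z. f z \<partial>action_step \<phi> \<mu>) = (\<integral>x. \<integral>a. f (x, a) \<partial>\<phi> x \<partial>\<mu>)"
proof -
  have \<phi>': "\<phi> \<in> states M \<rightarrow>\<^sub>M prob_algebra (actions M)" using \<phi> by (simp add: stationary_kernels_def)
  have s\<mu>: "sets \<mu> = sets (states M)" and "prob_space \<mu>" using \<mu> by (auto simp: space_prob_algebra)
  have k: "(\<lambda>x. \<phi> x \<bind> (\<lambda>a. return (pair_space M) (x, a))) \<in> \<mu> \<rightarrow>\<^sub>M subprob_algebra (pair_space M)"
    unfolding measurable_cong_sets[OF s\<mu> refl] by (rule measurable_prob_algebraD[OF action_kernel[OF \<phi>']])
  have le1: "emeasure \<rho> (space \<rho>) \<le> ennreal 1" if "\<rho> \<in> space (subprob_algebra N)" for \<rho> N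
    using that by (auto simp: space_subprob_algebra subprob_space.emeasure_space_le_1)
  have inner: "(\<integral>z. f z \<partial>(\<phi> x \<bind> (\<lambda>a. return (pair_space M) (x, a)))) = (\<integral>a. f (x, a) \<partial>\<phi> x)"
    if x: "x \<in> space (states M)" for x
  proof -
    have s: "sets (\<phi> x) = sets (actions M)" and ps: "prob_space (\<phi> x)"
      using measurable_space[OF \<phi>' x] by (auto simp: space_prob_algebra)
    have r: "(\<lambda>a. return (pair_space M) (x, a)) \<in> \<phi> x \<rightarrow>\<^sub>M subprob_algebra (pair_space M)"
      unfolding measurable_cong_sets[OF s refl] using x by (simp add: pair_space_def)
    have "(\<integral>z. f z \<partial>(\<phi> x \<bind> (\<lambda>a. return (pair_space M) (x, a)))) =
        (\<integral>a. \<integral>z. f z \<partial>return (pair_space M) (x, a) \<partial>\<phi> x)"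
      by (rule integral_bind[OF f B r, where B'=1])
        (rule prob_space.finite_measure[OF ps] AE_I2 le1 measurable_space[OF r] | assumption)+
    also have "\<dots> = (\<integral>a. f (x, a) \<partial>\<phi> x)"
      using x sets_eq_imp_space_eq[OF s]
      by (intro Bochner_Integration.integral_cong refl integral_return f)
        (simp add: pair_space_def space_pair_measure)
    finally show ?thesis .
  qed
  have "(\<integral>z. f z \<partial>action_step \<phi> \<mu>) = (\<integral>x. \<integral>z. f z \<partial>(\<phi> x \<bind> (\<lambda>a. return (pair_space M) (x, a))) \<partial>\<mu>)"
    unfolding action_step_def
    by (rule integral_bind[OF f B k, where B'=1])
      (rule prob_space.finite_measure[OF \<open>prob_space \<mu>\<close>] AE_I2 le1 measurable_space[OF k] | assumption)+
  also have "\<dots> = (\<integral>x. \<integral>a. f (x, a) \<partial>\<phi> x \<partial>\<mu>)"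
    by (intro Bochner_Integration.integral_cong refl inner) (simp add: sets_eq_imp_space_eq[OF s\<mu>])
  finally show ?thesis .
qed

lemma integral_stationary_marginal_Suc:
  fixes f :: "'x \<times> 'a \<Rightarrow> real"
  assumes \<phi>: "\<phi> \<in> stationary_kernels M"
    and f: "f \<in> borel_measurable (pair_space M)" and B: "\<And>z. z \<in> space (pair_space M) \<Longrightarrow> \<bar>f z\<bar> \<le> B"
  shows "(\<integral>z. f z \<partial>marginal (stationary_policy \<phi>) (Suc t)) =
    (\<integral>z. \<integral>y. f y \<partial>action_step \<phi> (trans M z) \<partial>marginal (stationary_policy \<phi>) t)"
proof -
  note K = stationary_step_kernel[OF \<phi>]
  have s: "sets (marginal (stationary_policy \<phi>) t) = sets (pair_space M)"
    and p: "prob_space (marginal (stationary_policy \<phi>) t)"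
    using marginal_in_prob_algebra[OF stationary_policy_in_policies[OF \<phi>]] by (auto simp: space_prob_algebra)
  show ?thesis unfolding stationary_marginal_Suc[OF \<phi>]
  proof (rule integral_bind[OF f B, where B'=1])
    show "(\<lambda>z. action_step \<phi> (trans M z)) \<in> marginal (stationary_policy \<phi>) t \<rightarrow>\<^sub>M subprob_algebra (pair_space M)"
      unfolding measurable_cong_sets[OF s refl] by (rule measurable_prob_algebraD[OF K])
    show "AE z in marginal (stationary_policy \<phi>) t. emeasure (action_step \<phi> (trans M z)) (space (action_step \<phi> (trans M z))) \<le> ennreal 1"
      using measurable_space[OF K] sets_eq_imp_space_eq[OF s]
      by (auto intro!: AE_I2 simp: space_prob_algebra prob_space.emeasure_space_1)
  qed (auto intro: prob_space.finite_measure[OF p])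
qed

end

section \<open>Perturbing the transition kernel\<close>

locale mdp_perturbation = M: mdp M + M': mdp M' for M M' :: "('x, 'a, 'l) cmdp" +
  fixes \<phi> :: "'x \<Rightarrow> 'a measure" and \<delta> :: real
  assumes same_states: "states M' = states M" and same_actions: "actions M' = actions M"
    and same_init: "init M' = init M"
    and \<phi>: "\<phi> \<in> stationary_kernels M"
    and tv: "\<And>z. z \<in> space (pair_space M) \<Longrightarrow> tv_dist (trans M z) (trans M' z) \<le> \<delta>"
begin

lemma same_pair_space: "pair_space M' = pair_space M"
  by (simp add: pair_space_def same_states same_actions)

lemma \<phi>': "\<phi> \<in> stationary_kernels M'"
  using \<phi> by (simp add: stationary_kernels_def same_states same_actions)

lemma action_step_same: "M'.action_step \<phi> \<mu> = M.action_step \<phi> \<mu>"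
  by (simp add: M.action_step_def M'.action_step_def same_pair_space)

abbreviation "\<mu> t \<equiv> M.marginal (stationary_policy \<phi>) t"
abbreviation "\<mu>' t \<equiv> M'.marginal (stationary_policy \<phi>) t"

lemma marginal_spaces: "\<mu> t \<in> space (prob_algebra (pair_space M))" "\<mu>' t \<in> space (prob_algebra (pair_space M))"
  using M.marginal_in_prob_algebra[OF M.stationary_policy_in_policies[OF \<phi>]]
    M'.marginal_in_prob_algebra[OF M'.stationary_policy_in_policies[OF \<phi>']]
  by (simp_all add: same_pair_space)

lemma trans_spaces:
  assumes "z \<in> space (pair_space M)"
  shows "trans M z \<in> space (prob_algebra (states M))" "trans M' z \<in> space (prob_algebra (states M))"
  using measurable_space[OF M.trans_kernel assms] measurable_space[OF M'.trans_kernel, of z] assms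
  by (simp_all add: same_pair_space same_states)

text \<open>Averaging \<open>f\<close> over the action first turns it into a function of the next state with the same bound,
  to which the total variation bound between the transition kernels applies.\<close>

lemma step_kernels_close:
  fixes f :: "'x \<times> 'a \<Rightarrow> real"
  assumes z: "z \<in> space (pair_space M)"
    and f: "f \<in> borel_measurable (pair_space M)" and B: "\<And>z. z \<in> space (pair_space M) \<Longrightarrow> \<bar>f z\<bar> \<le> B"
  shows "\<bar>(\<integral>y. f y \<partial>M.action_step \<phi> (trans M z)) - (\<integral>y. f y \<partial>M.action_step \<phi> (trans M' z))\<bar> \<le> B * \<delta>"
proof -
  have k: "\<phi> \<in> states M \<rightarrow>\<^sub>M prob_algebra (actions M)" using \<phi> by (simp add: stationary_kernels_def)
  let ?g = "\<lambda>x. \<integral>a. f (x, a) \<partial>\<phi> x"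
  have g: "?g \<in> borel_measurable (states M)"
    by (rule integral_measurable_kernel[where N="actions M"])
      (use f measurable_prob_algebraD[OF k] in \<open>simp_all add: pair_space_def\<close>)
  have gB: "\<bar>?g x\<bar> \<le> B" if x: "x \<in> space (states M)" for x
  proof (rule abs_integral_prob_le(1)[OF measurable_space[OF k x]])
    show "(\<lambda>a. f (x, a)) \<in> borel_measurable (actions M)" using x f by (simp add: pair_space_def)
    have "space (\<phi> x) = space (actions M)"
      using measurable_space[OF k x] by (auto simp: space_prob_algebra dest: sets_eq_imp_space_eq)
    then show "AE a in \<phi> x. \<bar>f (x, a)\<bar> \<le> B"
      using x by (intro AE_I2 B) (simp add: pair_space_def space_pair_measure)
  qed
  have "0 \<le> B" using B[OF z] by linarith
  have "\<bar>(\<integral>x. ?g x \<partial>trans M z) - (\<integral>x. ?g x \<partial>trans M' z)\<bar> \<le> B * tv_dist (trans M z) (trans M' z)"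
    by (rule bounded_integral_diff_le_tv_dist[OF trans_spaces[OF z] g gB])
  also have "\<dots> \<le> B * \<delta>" using tv[OF z] \<open>0 \<le> B\<close> by (rule mult_left_mono)
  finally show ?thesis
    using M.integral_action_step[OF \<phi> trans_spaces(1)[OF z] f B] M.integral_action_step[OF \<phi> trans_spaces(2)[OF z] f B]
    by simp
qed

text \<open>Telescoping: with one-step operators \<open>F\<close> and \<open>F'\<close>, the difference at time \<open>t + 1\<close> is the difference at
  time \<open>t\<close> tested on \<open>F f\<close>, whose bound is no larger than that of \<open>f\<close>, plus the integral of
  \<open>F f - F' f\<close>. This is why the test function is generalized in the induction.\<close>

lemma marginals_close:
  fixes f :: "'x \<times> 'a \<Rightarrow> real"
  assumes "f \<in> borel_measurable (pair_space M)" and "\<And>z. z \<in> space (pair_space M) \<Longrightarrow> \<bar>f z\<bar> \<le> B"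
  shows "\<bar>(\<integral>z. f z \<partial>\<mu> t) - (\<integral>z. f z \<partial>\<mu>' t)\<bar> \<le> real t * (B * \<delta>)"
  using assms
proof (induction t arbitrary: f)
  case 0
  have "\<mu> 0 = \<mu>' 0"
    by (rule prob_algebra_eqI[OF marginal_spaces])
      (simp add: M.nn_integral_stationary_marginal_0[OF \<phi>] M'.nn_integral_stationary_marginal_0[OF \<phi>']
        action_step_same same_pair_space same_init)
  then show ?case by simp
next
  case (Suc t)
  let ?F = "\<lambda>z. \<integral>y. f y \<partial>M.action_step \<phi> (trans M z)" and ?F' = "\<lambda>z. \<integral>y. f y \<partial>M.action_step \<phi> (trans M' z)"
  note K = M.stationary_step_kernel[OF \<phi>]
  have K': "(\<lambda>z. M.action_step \<phi> (trans M' z)) \<in> pair_space M \<rightarrow>\<^sub>M prob_algebra (pair_space M)"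
    using M'.stationary_step_kernel[OF \<phi>'] by (simp add: action_step_same same_pair_space)
  have Fm: "?F \<in> borel_measurable (pair_space M)" "?F' \<in> borel_measurable (pair_space M)"
    by (rule measurable_compose[OF measurable_prob_algebraD[OF K] integral_measurable_subprob_algebra[OF Suc.prems(1)]]
        measurable_compose[OF measurable_prob_algebraD[OF K'] integral_measurable_subprob_algebra[OF Suc.prems(1)]])+
  have bound: "\<bar>\<integral>y. f y \<partial>P\<bar> \<le> B" if "P \<in> space (prob_algebra (pair_space M))" for P
    using that Suc.prems(2) by (intro abs_integral_prob_le(1)[OF that Suc.prems(1)] AE_I2)
      (auto simp: space_prob_algebra dest: sets_eq_imp_space_eq)
  have FB: "\<bar>?F z\<bar> \<le> B" "\<bar>?F' z\<bar> \<le> B" if "z \<in> space (pair_space M)" for z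
    using measurable_space[OF K that] measurable_space[OF K' that] by (auto intro: bound)
  have sp: "space (\<mu>' t) = space (pair_space M)"
    using marginal_spaces(2)[of t] by (auto simp: space_prob_algebra dest: sets_eq_imp_space_eq)
  have int: "integrable (\<mu>' t) ?F" "integrable (\<mu>' t) ?F'"
    using Fm FB by (auto intro!: abs_integral_prob_le(2)[OF marginal_spaces(2), where B=B] AE_I2 simp: sp)
  have "(\<integral>z. f z \<partial>\<mu> (Suc t)) - (\<integral>z. f z \<partial>\<mu>' (Suc t)) = (\<integral>z. ?F z \<partial>\<mu> t) - (\<integral>z. ?F' z \<partial>\<mu>' t)"
    using M.integral_stationary_marginal_Suc[OF \<phi> Suc.prems] 
      M'.integral_stationary_marginal_Suc[OF \<phi>', unfolded same_pair_space action_step_same, OF Suc.prems]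
    by simp
  also have "\<dots> = ((\<integral>z. ?F z \<partial>\<mu> t) - (\<integral>z. ?F z \<partial>\<mu>' t)) + (\<integral>z. ?F z - ?F' z \<partial>\<mu>' t)"
    using int by simp
  also have "\<bar>\<dots>\<bar> \<le> real t * (B * \<delta>) + B * \<delta>"
  proof (rule order_trans[OF abs_triangle_ineq add_mono])
    show "\<bar>(\<integral>z. ?F z \<partial>\<mu> t) - (\<integral>z. ?F z \<partial>\<mu>' t)\<bar> \<le> real t * (B * \<delta>)"
      by (rule Suc.IH[OF Fm(1) FB(1)])
    show "\<bar>\<integral>z. ?F z - ?F' z \<partial>\<mu>' t\<bar> \<le> B * \<delta>"
      using Fm step_kernels_close[OF _ Suc.prems]
      by (intro abs_integral_prob_le(1)[OF marginal_spaces(2)] AE_I2) (auto simp: sp)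
  qed
  finally show ?case by (simp add: algebra_simps)
qed

text \<open>The error at time \<open>t\<close> is at most \<open>e + t B \<delta>\<close>. It is enlarged to \<open>e + (t + 1) B \<delta>\<close> because
  \<open>(1 - \<beta>) (\<Sum>t. (t + 1) \<beta> ^ t) = 1 / (1 - \<beta>)\<close>.\<close>

lemma disc_close:
  fixes f f' :: "'x \<times> 'a \<Rightarrow> real"
  assumes \<beta>: "0 < \<beta>" "\<beta> < 1"
    and f: "f \<in> borel_measurable (pair_space M)" "\<And>z. z \<in> space (pair_space M) \<Longrightarrow> \<bar>f z\<bar> \<le> B"
    and f': "f' \<in> borel_measurable (pair_space M)"
    and e: "\<And>z. z \<in> space (pair_space M) \<Longrightarrow> \<bar>f z - f' z\<bar> \<le> e"
    and \<delta>: "0 \<le> \<delta>"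
  shows "\<bar>disc \<beta> M f (stationary_policy \<phi>) - disc \<beta> M' f' (stationary_policy \<phi>)\<bar> \<le> e + B * \<delta> / (1 - \<beta>)"
proof -
  note p = M.stationary_policy_in_policies[OF \<phi>] and p' = M'.stationary_policy_in_policies[OF \<phi>']
  let ?m = "\<lambda>t. \<integral>z. f z \<partial>\<mu> t" and ?m' = "\<lambda>t. \<integral>z. f' z \<partial>\<mu>' t"
  have f'B: "\<bar>f' z\<bar> \<le> B + e" if "z \<in> space (pair_space M)" for z
    using f(2)[OF that] e[OF that] by linarith
  have sp: "space (\<mu>' t) = space (pair_space M)" for t
    using marginal_spaces(2)[of t] by (auto simp: space_prob_algebra dest: sets_eq_imp_space_eq)
  \<comment> \<open>The bound \<open>B\<close> is nonnegative because there is a state-action pair.\<close>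
  obtain z0 where "z0 \<in> space (pair_space M)"
    using marginal_spaces(2)[of 0] sp[of 0] prob_space.not_empty[of "\<mu>' 0"] by (auto simp: space_prob_algebra)
  then have "0 \<le> B" using f(2)[of z0] by linarith
  have diff: "\<bar>?m t - ?m' t\<bar> \<le> e + real (Suc t) * (B * \<delta>)" for t
  proof -
    have "integrable (\<mu>' t) f" "integrable (\<mu>' t) f'"
      using f f' f'B by (auto intro!: abs_integral_prob_le(2)[OF marginal_spaces(2)] AE_I2 simp: sp)
    then have "?m t - ?m' t = (?m t - (\<integral>z. f z \<partial>\<mu>' t)) + (\<integral>z. f z - f' z \<partial>\<mu>' t)" by simp
    also have "\<bar>\<dots>\<bar> \<le> real t * (B * \<delta>) + e"
      using e f(1) f'
      by (intro order_trans[OF abs_triangle_ineq add_mono] marginals_close[OF f] 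
          abs_integral_prob_le(1)[OF marginal_spaces(2)] AE_I2) (auto simp: sp)
    finally show ?thesis using mult_nonneg_nonneg[OF \<open>0 \<le> B\<close> \<delta>] by (simp add: distrib_right)
  qed
  have s: "summable (\<lambda>t. \<beta> ^ t * ?m t)"
    by (rule M.summable_discounted[OF p \<beta> f])
  have s': "summable (\<lambda>t. \<beta> ^ t * ?m' t)"
    by (rule M'.summable_discounted[OF p' \<beta>, unfolded same_pair_space, OF f' f'B])
  have "(\<lambda>t. e * \<beta> ^ t + (B * \<delta>) * (real (Suc t) * \<beta> ^ t)) sums (e * (1 / (1 - \<beta>)) + (B * \<delta>) * (1 / (1 - \<beta>)\<^sup>2))"
    using \<beta> by (intro sums_add sums_mult geometric_sums geometric_deriv_sums) auto
  then have sums: "(\<lambda>t. \<beta> ^ t * (e + real (Suc t) * (B * \<delta>))) sums (e / (1 - \<beta>) + B * \<delta> / (1 - \<beta>)\<^sup>2)"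
    by (simp add: algebra_simps)
  have "\<bar>(\<Sum>t. \<beta> ^ t * ?m t) - (\<Sum>t. \<beta> ^ t * ?m' t)\<bar> = \<bar>\<Sum>t. \<beta> ^ t * (?m t - ?m' t)\<bar>"
    using suminf_diff[OF s s'] by (simp add: algebra_simps)
  also have "\<dots> \<le> (\<Sum>t. \<beta> ^ t * (e + real (Suc t) * (B * \<delta>)))"
  proof -
    have b: "norm (\<beta> ^ t * (?m t - ?m' t)) \<le> \<beta> ^ t * (e + real (Suc t) * (B * \<delta>))" for t
      using mult_left_mono[OF diff[of t], of "\<beta> ^ t"] \<beta> by (simp add: abs_mult)
    show ?thesis
      using norm_suminf_le[OF b sums_summable[OF sums]] by simp
  qed
  also have "\<dots> = e / (1 - \<beta>) + B * \<delta> / (1 - \<beta>)\<^sup>2"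
    using sums by (rule sums_unique[symmetric])
  finally have "(1 - \<beta>) * \<bar>(\<Sum>t. \<beta> ^ t * ?m t) - (\<Sum>t. \<beta> ^ t * ?m' t)\<bar> \<le>
      (1 - \<beta>) * (e / (1 - \<beta>) + B * \<delta> / (1 - \<beta>)\<^sup>2)"
    using \<beta> by (intro mult_left_mono) auto
  also have "\<dots> = e + B * \<delta> / (1 - \<beta>)"
  proof -
    have "u * (e / u + c / u\<^sup>2) = e + c / u" if "u \<noteq> 0" for u c :: real
      using that by (simp add: field_simps power2_eq_square)
    then show ?thesis using \<beta> by simp
  qed
  also have "disc \<beta> M f (stationary_policy \<phi>) = (1 - \<beta>) * (\<Sum>t. \<beta> ^ t * ?m t)"
    by (rule M.disc_eq_suminf_marginal[OF p \<beta> f])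
  moreover have "disc \<beta> M' f' (stationary_policy \<phi>) = (1 - \<beta>) * (\<Sum>t. \<beta> ^ t * ?m' t)"
    by (rule M'.disc_eq_suminf_marginal[OF p' \<beta>, unfolded same_pair_space, OF f' f'B])
  ultimately show ?thesis
    using \<beta> by (simp add: right_diff_distrib[symmetric] abs_mult)
qed

end

section \<open>Lumping states\<close>

text \<open>Lumpability: the image under \<open>S\<close> of the next state's law depends on the current state only through
  its own image, and the policy sees only that image.\<close>

locale mdp_lumping = M: mdp M + M': mdp M'
  for M :: "('x, 'a, 'l) cmdp" and M' :: "('y, 'a, 'l) cmdp" +
  fixes S :: "'x \<Rightarrow> 'y" and \<phi> :: "'y \<Rightarrow> 'a measure"
  assumes same_actions: "actions M' = actions M"
    and S: "S \<in> states M \<rightarrow>\<^sub>M states M'"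
    and init_lump: "init M' = distr (init M) (states M') S"
    and trans_lump: "\<And>x a. (x, a) \<in> space (pair_space M) \<Longrightarrow>
      trans M' (S x, a) = distr (trans M (x, a)) (states M') S"
    and \<phi>: "\<phi> \<in> stationary_kernels M'"
begin

lemma lift_kernel: "(\<lambda>x. \<phi> (S x)) \<in> stationary_kernels M"
  using \<phi> measurable_compose[OF S] by (simp add: stationary_kernels_def same_actions)

abbreviation lump :: "'x \<times> 'a \<Rightarrow> 'y \<times> 'a" where
  "lump \<equiv> \<lambda>(x, a). (S x, a)"

lemma lump_measurable: "lump \<in> pair_space M \<rightarrow>\<^sub>M pair_space M'"
proof -
  note S[measurable]
  show ?thesis unfolding pair_space_def same_actions by measurable
qed

lemma nn_integral_action_step_lump:
  assumes \<mu>: "sets \<mu> = sets (states M)" and g: "g \<in> borel_measurable (pair_space M')"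
  shows "(\<integral>\<^sup>+z. g z \<partial>M'.action_step \<phi> (distr \<mu> (states M') S)) =
    (\<integral>\<^sup>+z. g (lump z) \<partial>M.action_step (\<lambda>x. \<phi> (S x)) \<mu>)"
proof -
  have k: "\<phi> \<in> states M' \<rightarrow>\<^sub>M prob_algebra (actions M')" using \<phi> by (simp add: stationary_kernels_def)
  have k': "(\<lambda>x. \<phi> (S x)) \<in> states M \<rightarrow>\<^sub>M prob_algebra (actions M)"
    using lift_kernel by (simp add: stationary_kernels_def)
  have m: "(\<lambda>x. \<integral>\<^sup>+a. g (x, a) \<partial>\<phi> x) \<in> borel_measurable (states M')"
    by (rule nn_integral_measurable_subprob_algebra2[where N="actions M'"])
      (use g measurable_prob_algebraD[OF k] in \<open>simp_all add: pair_space_def\<close>)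
  show ?thesis
    unfolding M'.nn_integral_action_step[OF k sets_distr g]
      M.nn_integral_action_step[OF k' \<mu> measurable_compose[OF lump_measurable g]]
    by (subst nn_integral_distr) (use S m in \<open>simp_all add: measurable_cong_sets[OF \<mu> refl]\<close>)
qed

text \<open>Induction over time with an arbitrary test function, since one step back in time replaces \<open>g\<close> by its
  one-step average.\<close>

lemma nn_integral_marginal_lump:
  assumes "g \<in> borel_measurable (pair_space M')"
  shows "(\<integral>\<^sup>+z. g z \<partial>M'.marginal (stationary_policy \<phi>) t) =
    (\<integral>\<^sup>+z. g (lump z) \<partial>M.marginal (stationary_policy (\<lambda>x. \<phi> (S x))) t)"
  using assms
proof (induction t arbitrary: g)
  case (0 g)
  have "sets (init M) = sets (states M)" using M.init_prob by (simp add: space_prob_algebra)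
  then show ?case
    using nn_integral_action_step_lump[OF _ 0, of "init M"]
    by (simp add: M'.nn_integral_stationary_marginal_0[OF \<phi> 0] init_lump
        M.nn_integral_stationary_marginal_0[OF lift_kernel measurable_compose[OF lump_measurable 0]])
next
  case (Suc t g)
  let ?K' = "\<lambda>z. M'.action_step \<phi> (trans M' z)" and ?K = "\<lambda>z. M.action_step (\<lambda>x. \<phi> (S x)) (trans M z)"
  let ?\<mu> = "M.marginal (stationary_policy (\<lambda>x. \<phi> (S x))) t" and ?\<mu>' = "M'.marginal (stationary_policy \<phi>) t"
  note K' = M'.stationary_step_kernel[OF \<phi>] and K = M.stationary_step_kernel[OF lift_kernel]
  have s: "sets ?\<mu> = sets (pair_space M)"
    using M.marginal_in_prob_algebra[OF M.stationary_policy_in_policies[OF lift_kernel]]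
    by (simp add: space_prob_algebra)
  have s': "sets ?\<mu>' = sets (pair_space M')"
    using M'.marginal_in_prob_algebra[OF M'.stationary_policy_in_policies[OF \<phi>]]
    by (simp add: space_prob_algebra)
  have m': "(\<lambda>z. \<integral>\<^sup>+y. g y \<partial>?K' z) \<in> borel_measurable (pair_space M')"
    by (rule measurable_compose[OF measurable_prob_algebraD[OF K'] nn_integral_measurable_subprob_algebra[OF Suc.prems]])
  have k1: "?K' \<in> ?\<mu>' \<rightarrow>\<^sub>M subprob_algebra (pair_space M')"
    unfolding measurable_cong_sets[OF s' refl] by (rule measurable_prob_algebraD[OF K'])
  have k2: "?K \<in> ?\<mu> \<rightarrow>\<^sub>M subprob_algebra (pair_space M)"
    unfolding measurable_cong_sets[OF s refl] by (rule measurable_prob_algebraD[OF K])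
  have "(\<integral>\<^sup>+z. g z \<partial>M'.marginal (stationary_policy \<phi>) (Suc t)) = (\<integral>\<^sup>+z. \<integral>\<^sup>+y. g y \<partial>?K' z \<partial>?\<mu>')"
    unfolding M'.stationary_marginal_Suc[OF \<phi>] by (rule nn_integral_bind[OF Suc.prems k1])
  also have "\<dots> = (\<integral>\<^sup>+z. \<integral>\<^sup>+y. g y \<partial>?K' (lump z) \<partial>?\<mu>)"
    by (rule Suc.IH[OF m'])
  also have "\<dots> = (\<integral>\<^sup>+z. \<integral>\<^sup>+y. g (lump y) \<partial>?K z \<partial>?\<mu>)"
  proof (rule nn_integral_cong)
    fix z assume "z \<in> space ?\<mu>"
    then have z: "z \<in> space (pair_space M)" by (simp add: sets_eq_imp_space_eq[OF s])
    then have "sets (trans M z) = sets (states M)"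
      using measurable_space[OF M.trans_kernel] by (auto simp: space_prob_algebra)
    from nn_integral_action_step_lump[OF this Suc.prems]
    show "(\<integral>\<^sup>+y. g y \<partial>?K' (lump z)) = (\<integral>\<^sup>+y. g (lump y) \<partial>?K z)"
      using trans_lump[of "fst z" "snd z"] z by (simp add: split_def)
  qed
  also have "\<dots> = (\<integral>\<^sup>+z. g (lump z) \<partial>M.marginal (stationary_policy (\<lambda>x. \<phi> (S x))) (Suc t))"
    unfolding M.stationary_marginal_Suc[OF lift_kernel]
    by (rule nn_integral_bind[OF measurable_compose[OF lump_measurable Suc.prems] k2, symmetric])
  finally show ?case .
qed

lemma disc_lump:
  fixes f :: "'y \<times> 'a \<Rightarrow> real"
  assumes \<beta>: "0 < \<beta>" "\<beta> < 1"
    and f: "f \<in> borel_measurable (pair_space M')" "\<And>z. z \<in> space (pair_space M') \<Longrightarrow> \<bar>f z\<bar> \<le> B"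
  shows "disc \<beta> M' f (stationary_policy \<phi>) = disc \<beta> M (\<lambda>z. f (lump z)) (stationary_policy (\<lambda>x. \<phi> (S x)))"
proof -
  note p' = M'.stationary_policy_in_policies[OF \<phi>] and p = M.stationary_policy_in_policies[OF lift_kernel]
  have eq: "M'.marginal (stationary_policy \<phi>) t =
      distr (M.marginal (stationary_policy (\<lambda>x. \<phi> (S x))) t) (pair_space M') lump" for t
  proof (rule prob_algebra_eqI[OF M'.marginal_in_prob_algebra[OF p']])
    let ?\<mu> = "M.marginal (stationary_policy (\<lambda>x. \<phi> (S x))) t"
    have s: "sets ?\<mu> = sets (pair_space M)" and pr: "prob_space ?\<mu>"
      using M.marginal_in_prob_algebra[OF p] by (auto simp: space_prob_algebra)
    have l: "lump \<in> ?\<mu> \<rightarrow>\<^sub>M pair_space M'"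
      unfolding measurable_cong_sets[OF s refl] by (rule lump_measurable)
    show "distr ?\<mu> (pair_space M') lump \<in> space (prob_algebra (pair_space M'))"
      using prob_space.prob_space_distr[OF pr l] by (simp add: space_prob_algebra)
    fix g :: "'y \<times> 'a \<Rightarrow> ennreal" assume g: "g \<in> borel_measurable (pair_space M')"
    show "(\<integral>\<^sup>+z. g z \<partial>M'.marginal (stationary_policy \<phi>) t) = (\<integral>\<^sup>+z. g z \<partial>distr ?\<mu> (pair_space M') lump)"
      using nn_integral_marginal_lump[OF g] l g by (simp add: nn_integral_distr)
  qed
  have i: "(\<integral>z. f z \<partial>M'.marginal (stationary_policy \<phi>) t) =
    (\<integral>z. f (lump z) \<partial>M.marginal (stationary_policy (\<lambda>x. \<phi> (S x))) t)" for t
  proof -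
    have s: "sets (M.marginal (stationary_policy (\<lambda>x. \<phi> (S x))) t) = sets (pair_space M)"
      using M.marginal_in_prob_algebra[OF p] by (auto simp: space_prob_algebra)
    show ?thesis unfolding eq
      by (rule integral_distr[OF _ f(1)]) (simp only: measurable_cong_sets[OF s refl] lump_measurable)
  qed
  have b: "\<bar>f (lump z)\<bar> \<le> B" if "z \<in> space (pair_space M)" for z
    using f(2)[OF measurable_space[OF lump_measurable that]] .
  show ?thesis
    using M'.disc_eq_suminf_marginal[OF p' \<beta> f]
      M.disc_eq_suminf_marginal[OF p \<beta> measurable_compose[OF lump_measurable f(1)] b]
    by (simp only: i)
qed

end

section \<open>Quantized models\<close>

text \<open>\<open>Q\<close> labels a finite measurable partition into cells of positive mass; this is the setting in which
  the averaged model lumps to the finite one.\<close>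

locale quantization = mdp M for M :: "('x, 'a, 'l) cmdp" +
  fixes G :: "'x set" and Q :: "'x \<Rightarrow> 'x" and \<nu> :: "'x measure"
  assumes finite_G: "finite G"
    and Q: "Q \<in> states M \<rightarrow>\<^sub>M count_space G"
    and sets_\<nu>: "sets \<nu> = sets (states M)" and finite_\<nu>: "finite_measure \<nu>"
    and cell_pos: "\<And>y. y \<in> G \<Longrightarrow> 0 < emeasure \<nu> (cell M Q y)"
begin

abbreviation "averaged \<equiv> averaged_model M Q \<nu>"
abbreviation "lumped \<equiv> finite_model M G Q \<nu>"

lemma cell_sets: "cell M Q y \<in> sets (states M)"
proof -
  have "cell M Q y = Q -` ({y} \<inter> G) \<inter> space (states M)"
    using measurable_space[OF Q] by (auto simp: cell_def)
  also have "\<dots> \<in> sets (states M)" by (rule measurable_sets[OF Q]) simp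
  finally show ?thesis .
qed

lemma cell_measure_prob:
  assumes "y \<in> G"
  shows "cell_measure M Q \<nu> y \<in> space (prob_algebra (states M))"
proof -
  have "prob_space (cell_measure M Q \<nu> y)"
    unfolding cell_measure_def using cell_pos[OF assms] finite_measure.emeasure_finite[OF finite_\<nu>]
    by (intro prob_space_uniform_measure) auto
  then show ?thesis by (simp add: space_prob_algebra cell_measure_def sets_\<nu>)
qed

lemma AE_cell_measure: "AE z in cell_measure M Q \<nu> y. z \<in> cell M Q y"
  unfolding cell_measure_def by (rule AE_uniform_measureI) (simp_all add: sets_\<nu> cell_sets)

lemma cell_kernel: "cell_measure M Q \<nu> \<in> count_space G \<rightarrow>\<^sub>M prob_algebra (states M)"
  using cell_measure_prob by simp

lemma averaged_simps:
  "states averaged = states M" "actions averaged = actions M" "init averaged = init M"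
  "pair_space averaged = pair_space M"
  by (simp_all add: averaged_model_def pair_space_def)

lemma lumped_simps:
  "states lumped = count_space G" "actions lumped = actions M"
  "pair_space lumped = count_space G \<Otimes>\<^sub>M actions M"
  by (simp_all add: finite_model_def pair_space_def)

text \<open>Both reduced models take their transitions from this kernel: the averaged model evaluates it at the
  cell of the current state, and the finite model pushes its values forward to the grid.\<close>

definition cell_trans :: "'x \<times> 'a \<Rightarrow> 'x measure" where
  "cell_trans = (\<lambda>(y, a). cell_measure M Q \<nu> y \<bind> (\<lambda>z. trans M (z, a)))"

lemma cell_trans_kernel: "cell_trans \<in> count_space G \<Otimes>\<^sub>M actions M \<rightarrow>\<^sub>M prob_algebra (states M)"
proof -
  have "(\<lambda>p. cell_measure M Q \<nu> (fst p) \<bind> (\<lambda>z. trans M (z, snd p)))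
      \<in> count_space G \<Otimes>\<^sub>M actions M \<rightarrow>\<^sub>M prob_algebra (states M)"
  proof (rule measurable_bind_prob_space2[OF measurable_compose[OF measurable_fst cell_kernel]])
    have "(\<lambda>q. (snd q, snd (fst q))) \<in> (count_space G \<Otimes>\<^sub>M actions M) \<Otimes>\<^sub>M states M \<rightarrow>\<^sub>M pair_space M"
      unfolding pair_space_def by measurable
    from measurable_compose[OF this trans_kernel]
    show "(\<lambda>(p, z). trans M (z, snd p)) \<in> (count_space G \<Otimes>\<^sub>M actions M) \<Otimes>\<^sub>M states M \<rightarrow>\<^sub>M prob_algebra (states M)"
      by (simp add: split_def)
  qed
  then show ?thesis by (simp add: cell_trans_def split_def)
qed

definition cell_average :: "('x \<times> 'a \<Rightarrow> real) \<Rightarrow> 'x \<times> 'a \<Rightarrow> real" where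
  "cell_average f = (\<lambda>(y, a). \<integral>z. f (z, a) \<partial>cell_measure M Q \<nu> y)"

lemma cell_average_measurable:
  assumes f: "f \<in> borel_measurable (pair_space M)"
  shows "cell_average f \<in> borel_measurable (count_space G \<Otimes>\<^sub>M actions M)"
proof -
  have "(\<lambda>q. (snd q, snd (fst q))) \<in> (count_space G \<Otimes>\<^sub>M actions M) \<Otimes>\<^sub>M states M \<rightarrow>\<^sub>M pair_space M"
    unfolding pair_space_def by measurable
  from measurable_compose[OF this f]
  have "(\<lambda>(p, z). f (z, snd p)) \<in> borel_measurable ((count_space G \<Otimes>\<^sub>M actions M) \<Otimes>\<^sub>M states M)"
    by (simp add: split_def)
  from integral_measurable_kernel[OF this
      measurable_prob_algebraD[OF measurable_compose[OF measurable_fst cell_kernel]]]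
  show ?thesis by (simp add: cell_average_def split_def)
qed

lemma quantize_measurable: "(\<lambda>(x, a). (Q x, a)) \<in> pair_space M \<rightarrow>\<^sub>M count_space G \<Otimes>\<^sub>M actions M"
proof -
  note Q[measurable]
  show ?thesis unfolding pair_space_def by measurable
qed

lemma averaged_trans: "trans averaged (x, a) = cell_trans (Q x, a)"
  by (simp add: averaged_model_def cell_trans_def)

lemma mdp_averaged: "mdp averaged"
proof
  have "trans averaged = (\<lambda>z. cell_trans (case z of (x, a) \<Rightarrow> (Q x, a)))"
    by (auto simp: averaged_trans)
  then show "trans averaged \<in> pair_space averaged \<rightarrow>\<^sub>M prob_algebra (states averaged)"
    using measurable_compose[OF quantize_measurable cell_trans_kernel] by (simp add: averaged_simps)
  show "init averaged \<in> space (prob_algebra (states averaged))"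
    using init_prob by (simp add: averaged_simps)
qed

lemma cell_eq_vimage: "Q -` {y} \<inter> space (states M) = cell M Q y"
  by (auto simp: cell_def)

text \<open>On a finite grid it suffices to compare point masses, and a point mass of the image is the mean
  probability of the corresponding cell.\<close>

lemma lumped_trans:
  assumes y: "y \<in> G" and a: "a \<in> space (actions M)"
  shows "trans lumped (y, a) = distr (cell_trans (y, a)) (count_space G) Q"
proof (rule measure_eqI_finite)
  show "sets (trans lumped (y, a)) = Pow G" "sets (distr (cell_trans (y, a)) (count_space G) Q) = Pow G"
    by (simp_all add: finite_model_def sets_point_measure)
  show "finite G" by (rule finite_G)
  fix y' assume y': "y' \<in> G"
  have ya: "(y, a) \<in> space (count_space G \<Otimes>\<^sub>M actions M)" using y a by (simp add: space_pair_measure)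
  have q: "sets (cell_trans (y, a)) = sets (states M)" and pq: "prob_space (cell_trans (y, a))"
    using measurable_space[OF cell_trans_kernel ya] by (auto simp: space_prob_algebra)
  have sc: "sets (cell_measure M Q \<nu> y) = sets (states M)" and pc: "prob_space (cell_measure M Q \<nu> y)"
    using cell_measure_prob[OF y] by (auto simp: space_prob_algebra)
  interpret pq: prob_space "cell_trans (y, a)" by (rule pq)
  interpret pc: prob_space "cell_measure M Q \<nu> y" by (rule pc)
  have "(\<lambda>z. trans M (z, a)) \<in> states M \<rightarrow>\<^sub>M subprob_algebra (states M)"
    using measurable_prob_algebraD[OF trans_kernel] a by (simp add: pair_space_def)
  then have k: "(\<lambda>z. trans M (z, a)) \<in> cell_measure M Q \<nu> y \<rightarrow>\<^sub>M subprob_algebra (states M)"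
    by (simp add: measurable_cong_sets[OF sc refl])
  have "emeasure (distr (cell_trans (y, a)) (count_space G) Q) {y'} = emeasure (cell_trans (y, a)) (cell M Q y')"
    using y' Q by (subst emeasure_distr) (auto simp: measurable_cong_sets[OF q refl] sets_eq_imp_space_eq[OF q] cell_eq_vimage)
  also have "\<dots> = ennreal (measure (cell_trans (y, a)) (cell M Q y'))" by (rule pq.emeasure_eq_measure)
  also have "measure (cell_trans (y, a)) (cell M Q y') =
      (\<integral>z. measure (trans M (z, a)) (cell M Q y') \<partial>cell_measure M Q \<nu> y)"
    unfolding cell_trans_def by (simp add: pc.measure_bind[OF k cell_sets])
  finally show "emeasure (trans lumped (y, a)) {y'} = emeasure (distr (cell_trans (y, a)) (count_space G) Q) {y'}"
    using y' by (simp add: finite_model_def emeasure_point_measure_finite finite_G)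
qed

lemma mdp_lumped: "mdp lumped"
proof
  have "(\<lambda>z. distr (cell_trans z) (count_space G) Q) \<in> count_space G \<Otimes>\<^sub>M actions M \<rightarrow>\<^sub>M prob_algebra (count_space G)"
    by (rule measurable_compose[OF cell_trans_kernel measurable_distr_prob_space[OF Q]])
  moreover have "trans lumped z = distr (cell_trans z) (count_space G) Q"
    if "z \<in> space (count_space G \<Otimes>\<^sub>M actions M)" for z
    using lumped_trans[of "fst z" "snd z"] that by (auto simp: space_pair_measure)
  ultimately show "trans lumped \<in> pair_space lumped \<rightarrow>\<^sub>M prob_algebra (states lumped)"
    unfolding lumped_simps by (subst measurable_cong) auto
  have "init lumped = distr (init M) (count_space G) Q" by (simp add: finite_model_def)
  then show "init lumped \<in> space (prob_algebra (states lumped))"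
    using measurable_space[OF measurable_distr_prob_space[OF Q] init_prob] by (simp add: lumped_simps)
qed

lemma mdp_lumping:
  assumes "\<phi> \<in> stationary_kernels lumped"
  shows "mdp_lumping averaged lumped Q \<phi>"
proof (intro mdp_lumping.intro mdp_lumping_axioms.intro mdp_averaged mdp_lumped assms)
  fix x a assume "(x, a) \<in> space (pair_space averaged)"
  then have "x \<in> space (states M)" "a \<in> space (actions M)"
    by (auto simp: averaged_simps pair_space_def space_pair_measure)
  then show "trans lumped (Q x, a) = distr (trans averaged (x, a)) (states lumped) Q"
    using measurable_space[OF Q] by (simp add: lumped_trans averaged_trans lumped_simps)
qed (use Q in \<open>simp_all add: averaged_simps lumped_simps, simp add: finite_model_def\<close>)

text \<open>The averaged kernel is a mean of kernels at points of the same cell, and distance to a fixed measure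
  is convex.\<close>

lemma averaged_trans_tv_dist_le:
  assumes x: "x \<in> space (states M)" and a: "a \<in> space (actions M)"
    and tv: "\<And>z. z \<in> space (states M) \<Longrightarrow> Q z = Q x \<Longrightarrow> tv_dist (trans M (x, a)) (trans M (z, a)) \<le> \<delta>"
  shows "tv_dist (trans M (x, a)) (trans averaged (x, a)) \<le> \<delta>"
proof -
  let ?c = "cell_measure M Q \<nu> (Q x)"
  have y: "Q x \<in> G" using measurable_space[OF Q x] by simp
  note c = cell_measure_prob[OF y]
  have sc: "sets ?c = sets (states M)" and pc: "prob_space ?c" using c by (auto simp: space_prob_algebra)
  interpret pc: prob_space ?c by (rule pc)
  have kp: "(\<lambda>z. trans M (z, a)) \<in> states M \<rightarrow>\<^sub>M prob_algebra (states M)"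
    using trans_kernel a by (simp add: pair_space_def)
  have k: "(\<lambda>z. trans M (z, a)) \<in> ?c \<rightarrow>\<^sub>M subprob_algebra (states M)"
    unfolding measurable_cong_sets[OF sc refl] by (rule measurable_prob_algebraD[OF kp])
  have px: "trans M (x, a) \<in> space (prob_algebra (states M))" by (rule measurable_space[OF kp x])
  then have spx: "sets (trans M (x, a)) = sets (states M)" by (simp add: space_prob_algebra)
  show ?thesis unfolding tv_dist_def
  proof (rule cSUP_least)
    show "{g \<in> borel_measurable (trans M (x, a)). \<forall>y\<in>space (trans M (x, a)). \<bar>g y :: real\<bar> \<le> 1} \<noteq> {}"
      by (auto intro!: exI[of _ "\<lambda>_. 0"])
    fix g :: "'x \<Rightarrow> real"
    assume "g \<in> {g \<in> borel_measurable (trans M (x, a)). \<forall>y\<in>space (trans M (x, a)). \<bar>g y\<bar> \<le> 1}"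
    then have g: "g \<in> borel_measurable (states M)" and g1: "\<And>y. y \<in> space (states M) \<Longrightarrow> \<bar>g y\<bar> \<le> 1"
      by (auto simp: measurable_cong_sets[OF spx refl] sets_eq_imp_space_eq[OF spx])
    let ?I = "\<lambda>z. \<integral>y. g y \<partial>trans M (z, a)"
    have I: "?I \<in> borel_measurable (states M)"
      by (rule measurable_compose[OF measurable_prob_algebraD[OF kp] integral_measurable_subprob_algebra[OF g]])
    have I1: "\<bar>?I z\<bar> \<le> 1" if "z \<in> space (states M)" for z
      using measurable_space[OF kp that] g1
      by (intro abs_integral_prob_le(1)[OF measurable_space[OF kp that] g] AE_I2)
        (auto simp: space_prob_algebra dest: sets_eq_imp_space_eq)
    have "(\<integral>y. g y \<partial>trans averaged (x, a)) = (\<integral>z. ?I z \<partial>?c)"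
      unfolding averaged_trans cell_trans_def prod.case
      by (rule integral_bind[OF g g1 k, where B'=1])
        (use measurable_space[OF kp] in \<open>auto intro!: AE_I2 pc.finite_measure_axioms
          simp: sets_eq_imp_space_eq[OF sc] space_prob_algebra prob_space.emeasure_space_1\<close>)
    moreover have "integrable ?c ?I"
      by (rule abs_integral_prob_le(2)[OF c I, where B=1]) (use I1 in \<open>auto intro!: AE_I2 simp: sets_eq_imp_space_eq[OF sc]\<close>)
    ultimately have "?I x - (\<integral>y. g y \<partial>trans averaged (x, a)) = (\<integral>z. ?I x - ?I z \<partial>?c)"
      by (simp add: pc.prob_space)
    also have "\<bar>\<dots>\<bar> \<le> \<delta>"
    proof (rule abs_integral_prob_le(1)[OF c])
      show "(\<lambda>z. ?I x - ?I z) \<in> borel_measurable (states M)" using I by simp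
      show "AE z in ?c. \<bar>?I x - ?I z\<bar> \<le> \<delta>"
        using AE_cell_measure
      proof eventually_elim
        case (elim z)
        then have z: "z \<in> space (states M)" "Q z = Q x" by (auto simp: cell_def)
        show ?case
          using bounded_integral_diff_le_tv_dist[OF px measurable_space[OF kp z(1)] g g1] tv[OF z] by simp
      qed
    qed
    finally show "\<bar>(\<integral>y. g y \<partial>trans M (x, a)) - (\<integral>y. g y \<partial>trans averaged (x, a))\<bar> \<le> \<delta>" .
  qed
qed

lemma cell_average_close:
  assumes x: "x \<in> space (states M)" and a: "a \<in> space (actions M)"
    and f: "f \<in> borel_measurable (pair_space M)"
    and e: "\<And>z. z \<in> space (states M) \<Longrightarrow> Q z = Q x \<Longrightarrow> \<bar>f (x, a) - f (z, a)\<bar> \<le> e"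
  shows "\<bar>f (x, a) - cell_average f (Q x, a)\<bar> \<le> e"
proof -
  let ?c = "cell_measure M Q \<nu> (Q x)"
  have y: "Q x \<in> G" using measurable_space[OF Q x] by simp
  note c = cell_measure_prob[OF y]
  interpret pc: prob_space ?c using c by (simp add: space_prob_algebra)
  have fa: "(\<lambda>z. f (z, a)) \<in> borel_measurable (states M)" using f a by (simp add: pair_space_def)
  have near: "AE z in ?c. \<bar>f (x, a) - f (z, a)\<bar> \<le> e"
    using AE_cell_measure by eventually_elim (auto simp: cell_def intro: e)
  have "integrable ?c (\<lambda>z. f (z, a))"
    by (rule abs_integral_prob_le(2)[OF c fa, where B="\<bar>f (x, a)\<bar> + e"]) (use near in eventually_elim, linarith)
  then have "f (x, a) - cell_average f (Q x, a) = (\<integral>z. f (x, a) - f (z, a) \<partial>?c)"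
    by (simp add: cell_average_def pc.prob_space)
  also have "\<bar>\<dots>\<bar> \<le> e"
    using fa by (intro abs_integral_prob_le(1)[OF c _ near]) simp
  finally show ?thesis .
qed

text \<open>\<open>\<delta>\<close> and \<open>e\<close> bound the oscillation of the kernel and of \<open>f\<close> within a cell; for Lipschitz data they
  are multiples of the cell diameter.\<close>

lemma disc_averaged_close:
  assumes \<beta>: "0 < \<beta>" "\<beta> < 1" and \<phi>: "\<phi> \<in> stationary_kernels M"
    and f: "f \<in> borel_measurable (pair_space M)" "\<And>z. z \<in> space (pair_space M) \<Longrightarrow> \<bar>f z\<bar> \<le> B"
    and \<delta>: "0 \<le> \<delta>"
    and tv: "\<And>x z a. x \<in> space (states M) \<Longrightarrow> z \<in> space (states M) \<Longrightarrow> a \<in> space (actions M) \<Longrightarrow>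
      Q z = Q x \<Longrightarrow> tv_dist (trans M (x, a)) (trans M (z, a)) \<le> \<delta>"
    and e: "\<And>x z a. x \<in> space (states M) \<Longrightarrow> z \<in> space (states M) \<Longrightarrow> a \<in> space (actions M) \<Longrightarrow>
      Q z = Q x \<Longrightarrow> \<bar>f (x, a) - f (z, a)\<bar> \<le> e"
  shows "\<bar>disc \<beta> M f (stationary_policy \<phi>) -
    disc \<beta> averaged (\<lambda>(x, a). cell_average f (Q x, a)) (stationary_policy \<phi>)\<bar> \<le> e + B * \<delta> / (1 - \<beta>)"
proof -
  interpret mdp_perturbation M averaged \<phi> \<delta>
  proof (intro mdp_perturbation.intro mdp_perturbation_axioms.intro mdp_axioms mdp_averaged)
    show "z \<in> space (pair_space M) \<Longrightarrow> tv_dist (trans M z) (trans averaged z) \<le> \<delta>" for z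
      using averaged_trans_tv_dist_le[of "fst z" "snd z"] tv by (auto simp: pair_space_def space_pair_measure)
  qed (simp_all add: averaged_simps \<phi>)
  show ?thesis
  proof (rule disc_close[OF \<beta> f _ _ \<delta>])
    show "(\<lambda>(x, a). cell_average f (Q x, a)) \<in> borel_measurable (pair_space M)"
      using measurable_compose[OF quantize_measurable cell_average_measurable[OF f(1)]]
      by (simp add: split_def)
    show "\<bar>f z - (case z of (x, a) \<Rightarrow> cell_average f (Q x, a))\<bar> \<le> e" if "z \<in> space (pair_space M)" for z
      using cell_average_close[of "fst z" "snd z", OF _ _ f(1)] e that
      by (auto simp: pair_space_def space_pair_measure split_def)
  qed
qed

lemma disc_lumped_eq_averaged:
  assumes \<beta>: "0 < \<beta>" "\<beta> < 1" and \<phi>: "\<phi> \<in> stationary_kernels lumped"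
    and f: "f \<in> borel_measurable (pair_space M)" "\<And>z. z \<in> space (pair_space M) \<Longrightarrow> \<bar>f z\<bar> \<le> B"
  shows "disc \<beta> lumped (cell_average f) (stationary_policy \<phi>) =
    disc \<beta> averaged (\<lambda>(x, a). cell_average f (Q x, a)) (stationary_policy (extension Q \<phi>))"
proof -
  interpret mdp_lumping averaged lumped Q \<phi> by (rule mdp_lumping[OF \<phi>])
  have "\<bar>cell_average f z\<bar> \<le> B" if z: "z \<in> space (pair_space lumped)" for z
  proof -
    obtain y a where [simp]: "z = (y, a)" and y: "y \<in> G" and a: "a \<in> space (actions M)"
      using z by (auto simp: lumped_simps space_pair_measure)
    have "space (cell_measure M Q \<nu> y) = space (states M)"
      using cell_measure_prob[OF y] by (auto simp: space_prob_algebra dest: sets_eq_imp_space_eq)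
    then show ?thesis
      using f a by (auto simp: cell_average_def pair_space_def space_pair_measure
          intro!: abs_integral_prob_le(1)[OF cell_measure_prob[OF y]] AE_I2)
  qed
  from disc_lump[OF \<beta> _ this] cell_average_measurable[OF f(1)]
  show ?thesis by (simp add: lumped_simps split_def extension_def)
qed

lemma cost_models:
  "cost lumped = cell_average (cost M)" "cost averaged = (\<lambda>(x, a). cell_average (cost M) (Q x, a))"
  "constr lumped l = cell_average (constr M l)"
  "constr averaged l = (\<lambda>(x, a). cell_average (constr M l) (Q x, a))"
  by (simp_all add: finite_model_def averaged_model_def cell_average_def)

end

section \<open>Tightening the constraints\<close>

lemma optimal_imp_opt_value_eq:
  assumes "optimal \<beta> M m \<pi>"
  shows "opt_value \<beta> M m = disc \<beta> M (cost M) \<pi>"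
  unfolding opt_value_def using assms by (intro cInf_eq_minimum) (auto simp: optimal_def)

text \<open>With weight \<open>\<theta> = \<epsilon> / m\<close> on the Slater policy, the slack \<open>\<theta> \<alpha>'\<close> gained in each constraint is at least
  \<open>\<epsilon>\<close>, and the cost grows by at most \<open>\<theta> C\<close>.\<close>

lemma opt_value_tighten:
  fixes M :: "('x, 'a, 'l::finite) cmdp" and k \<alpha>' :: "real ^ 'l"
  assumes "mdp M" and \<beta>: "0 < \<beta>" "\<beta> < 1"
    and c: "cost M \<in> borel_measurable (pair_space M)"
      "\<And>z. z \<in> space (pair_space M) \<Longrightarrow> 0 \<le> cost M z" "\<And>z. z \<in> space (pair_space M) \<Longrightarrow> cost M z \<le> C"
    and d: "\<And>l. constr M l \<in> borel_measurable (pair_space M)"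
      "\<And>l z. z \<in> space (pair_space M) \<Longrightarrow> \<bar>constr M l z\<bar> \<le> D l"
    and slater: "\<pi>' \<in> policies M" "\<And>l. disc \<beta> M (constr M l) \<pi>' + \<alpha>' $ l = k $ l"
    and m: "\<And>l. m \<le> \<alpha>' $ l" and \<epsilon>: "0 < \<epsilon>" "\<epsilon> < m"
  shows "opt_value \<beta> M k \<le> opt_value \<beta> M (k - \<epsilon> *\<^sub>R 1)"
    and "opt_value \<beta> M (k - \<epsilon> *\<^sub>R 1) \<le> opt_value \<beta> M k + \<epsilon> * C / m"
proof -
  interpret mdp M by fact
  let ?J = "disc \<beta> M (cost M)"
  let ?F = "feasible \<beta> M k" and ?F' = "feasible \<beta> M (k - \<epsilon> *\<^sub>R 1)"
  have cb: "\<bar>cost M z\<bar> \<le> C" if "z \<in> space (pair_space M)" for z using c(2,3)[OF that] by simp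
  have J0: "0 \<le> ?J \<pi>" if "\<pi> \<in> policies M" for \<pi> by (rule disc_nonneg[OF that \<beta> c(1) cb c(2)])
  have bdd: "bdd_below (?J ` feasible \<beta> M m)" for m
    by (rule bdd_belowI2[where m=0]) (auto simp: feasible_def J0)
  have "(k - \<epsilon> *\<^sub>R 1) $ l \<le> k $ l" for l using \<epsilon> by simp
  then have sub: "?F' \<subseteq> ?F" by (auto simp: feasible_def intro: order_trans)
  have "disc \<beta> M (constr M l) \<pi>' \<le> (k - \<epsilon> *\<^sub>R 1) $ l" for l
    using slater(2)[of l] m[of l] \<epsilon> by simp
  then have ne: "\<pi>' \<in> ?F'" using slater(1) by (simp add: feasible_def)
  show "opt_value \<beta> M k \<le> opt_value \<beta> M (k - \<epsilon> *\<^sub>R 1)"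
    unfolding opt_value_def using ne sub by (intro cINF_superset_mono bdd) auto
  have "opt_value \<beta> M (k - \<epsilon> *\<^sub>R 1) - \<epsilon> * C / m \<le> ?J \<pi>" if \<pi>F: "\<pi> \<in> ?F" for \<pi>
  proof -
    have \<pi>: "\<pi> \<in> policies M" and feas: "\<And>l. disc \<beta> M (constr M l) \<pi> \<le> k $ l"
      using \<pi>F by (auto simp: feasible_def)
    define \<theta> where "\<theta> = \<epsilon> / m"
    have \<theta>: "0 \<le> 1 - \<theta>" "1 - \<theta> \<le> 1" "0 \<le> \<theta>" "\<theta> * m = \<epsilon>" using \<epsilon> by (auto simp: \<theta>_def)
    obtain \<rho> where \<rho>: "\<rho> \<in> policies M"
      and eq: "\<And>t. marginal \<rho> t = mixture (1 - \<theta>) (marginal \<pi> t) (marginal \<pi>' t)"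
      using mixed_policy[OF \<pi> slater(1) \<theta>(1,2)] by blast
    have "disc \<beta> M (constr M l) \<rho> \<le> (k - \<epsilon> *\<^sub>R 1) $ l" for l
    proof -
      have "disc \<beta> M (constr M l) \<rho> = (1 - \<theta>) * disc \<beta> M (constr M l) \<pi> + \<theta> * disc \<beta> M (constr M l) \<pi>'"
        using disc_mixed[OF \<rho> \<pi> slater(1) \<theta>(1,2) eq \<beta> d(1)[of l] d(2)] by simp
      also have "\<dots> \<le> (1 - \<theta>) * k $ l + \<theta> * (k $ l - \<alpha>' $ l)"
        using feas[of l] slater(2)[of l] \<theta> by (intro add_mono mult_left_mono) auto
      also have "\<dots> = k $ l - \<theta> * \<alpha>' $ l" by (simp add: algebra_simps)
      also have "\<dots> \<le> k $ l - \<theta> * m" using mult_left_mono[OF m[of l] \<theta>(3)] by linarith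
      finally show ?thesis by (simp add: \<theta>)
    qed
    then have "\<rho> \<in> ?F'" using \<rho> by (simp add: feasible_def)
    then have "opt_value \<beta> M (k - \<epsilon> *\<^sub>R 1) \<le> ?J \<rho>"
      unfolding opt_value_def by (rule cINF_lower[OF bdd])
    also have "?J \<rho> = (1 - \<theta>) * ?J \<pi> + \<theta> * ?J \<pi>'"
      using disc_mixed[OF \<rho> \<pi> slater(1) \<theta>(1,2) eq \<beta> c(1) cb] by simp
    also have "\<dots> \<le> 1 * ?J \<pi> + \<theta> * C"
      using J0[OF \<pi>] disc_le[OF slater(1) \<beta> c(1) cb] \<theta> by (intro add_mono mult_right_mono mult_left_mono) auto
    finally show ?thesis by (simp add: \<theta>_def)
  qed
  then have "opt_value \<beta> M (k - \<epsilon> *\<^sub>R 1) - \<epsilon> * C / m \<le> opt_value \<beta> M k"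
    unfolding opt_value_def[of \<beta> M k] using ne sub by (intro cINF_greatest) auto
  then show "opt_value \<beta> M (k - \<epsilon> *\<^sub>R 1) \<le> opt_value \<beta> M k + \<epsilon> * C / m" by simp
qed

section \<open>Near-optimality in the original model\<close>

text \<open>Translates the lower bounds on the number of grid points into bounds on the error terms. For
  \<open>a \<le> 0\<close> the conclusion is trivial, which matters because no sign is known for the rate constant.\<close>

lemma mult_root_inverse_le_1:
  fixes a :: real
  assumes "0 < D" "1 \<le> n" "a ^ D \<le> real n"
  shows "a * (1 / real n) powr (1 / real D) \<le> 1"
proof (cases "a \<le> 0")
  case True
  then show ?thesis by (intro order_trans[OF mult_nonpos_nonneg]) auto
next
  case False
  then have "a = (a ^ D) powr (1 / real D)"
    using assms by (simp add: powr_realpow[symmetric] powr_powr)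
  also have "\<dots> \<le> real n powr (1 / real D)" using assms False by (intro powr_mono2) auto
  finally show ?thesis using assms by (simp add: powr_divide divide_le_eq_1)
qed

theorem theorem8:
  fixes X :: "(real ^ 'd) set"
    and A :: "'a::polish_space set"
    and p :: "(real ^ 'd) \<times> 'a \<Rightarrow> (real ^ 'd) measure"
    and \<gamma> :: "(real ^ 'd) measure"
    and c :: "(real ^ 'd) \<times> 'a \<Rightarrow> real"
    and d :: "'q::finite \<Rightarrow> (real ^ 'd) \<times> 'a \<Rightarrow> real"
    and k \<alpha>' :: "real ^ 'q"
    and \<beta> \<alpha> \<kappa> \<epsilon> Kc Gp K Hc Hmax Yv :: real
    and Kd Hd :: "'q \<Rightarrow> real"
    and G :: "nat \<Rightarrow> (real ^ 'd) set"
    and Q :: "nat \<Rightarrow> real ^ 'd \<Rightarrow> real ^ 'd"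
    and \<nu> :: "nat \<Rightarrow> (real ^ 'd) measure"
    and M :: "(real ^ 'd, 'a, 'q) cmdp"
    and n :: nat
    and \<phi> :: "real ^ 'd \<Rightarrow> 'a measure"
  \<comment> \<open>the model\<close>
  assumes "compact X" and "compact A"
    and "p \<in> restrict_space borel X \<Otimes>\<^sub>M restrict_space borel A \<rightarrow>\<^sub>M
           prob_algebra (restrict_space borel X)"
    and "\<gamma> \<in> space (prob_algebra (restrict_space borel X))"
    and "continuous_on (X \<times> A) c" and "\<And>l. continuous_on (X \<times> A) (d l)"
    and "\<And>z. z \<in> X \<times> A \<Longrightarrow> 0 \<le> c z" and "\<And>l z. z \<in> X \<times> A \<Longrightarrow> 0 \<le> d l z"
    and "\<And>l. 0 \<le> k $ l"
    and M: "M = \<lparr>states = restrict_space borel X, actions = restrict_space borel A,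
                 trans = p, init = \<gamma>, cost = c, constr = d\<rparr>"
  \<comment> \<open>discounted criterion and Slater condition\<close>
    and "0 < \<beta>" and "\<beta> < 1"
    and "\<And>l. 0 < \<alpha>' $ l"
    and "\<exists>\<pi>\<in>policies M. \<forall>l. disc \<beta> M (d l) \<pi> + \<alpha>' $ l = k $ l"
  \<comment> \<open>finite models\<close>
    and "0 < \<alpha>"
    and "\<And>N. 1 \<le> N \<Longrightarrow> G N \<subseteq> X" and "\<And>N. 1 \<le> N \<Longrightarrow> card (G N) = N"
    and "\<And>N x. 1 \<le> N \<Longrightarrow> x \<in> X \<Longrightarrow>
           (MIN y\<in>G N. dist x y) \<le> \<alpha> * (1 / real N) powr (1 / real CARD('d))"
    and "\<And>N. 1 \<le> N \<Longrightarrow> Q N \<in> restrict_space borel X \<rightarrow>\<^sub>M count_space (G N)"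
    and "\<And>N x. 1 \<le> N \<Longrightarrow> x \<in> X \<Longrightarrow> dist x (Q N x) = (MIN y\<in>G N. dist x y)"
    and "\<And>N. 1 \<le> N \<Longrightarrow> sets (\<nu> N) = sets (restrict_space borel X)"
    and "\<And>N. 1 \<le> N \<Longrightarrow> finite_measure (\<nu> N)"
    and "\<And>N y. 1 \<le> N \<Longrightarrow> y \<in> G N \<Longrightarrow> 0 < emeasure (\<nu> N) (cell M (Q N) y)"
  \<comment> \<open>regularity\<close>
    and "\<And>x a. x \<in> X \<Longrightarrow> a \<in> A \<Longrightarrow>
           ((\<lambda>z. tv_dist (p z) (p (x, a))) \<longlongrightarrow> 0) (at (x, a) within X \<times> A)"
    and "\<And>a. a \<in> A \<Longrightarrow> Kc-lipschitz_on X (\<lambda>x. c (x, a))"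
    and "\<And>l a. a \<in> A \<Longrightarrow> (Kd l)-lipschitz_on X (\<lambda>x. d l (x, a))"
    and "\<And>x y a. x \<in> X \<Longrightarrow> y \<in> X \<Longrightarrow> a \<in> A \<Longrightarrow> tv_dist (p (x, a)) (p (y, a)) \<le> Gp * dist x y"
  \<comment> \<open>constants\<close>
    and K: "K = 2 * sup_norm_on (X \<times> A) c / (MIN l. \<alpha>' $ l)" and "K \<noteq> 0"
    and Hc: "Hc = (Kc + sup_norm_on (X \<times> A) c * Gp / (1 - \<beta>)) * (2 * \<alpha>)"
    and Hd: "\<And>l. Hd l = (Kd l + sup_norm_on (X \<times> A) (d l) * Gp / (1 - \<beta>)) * (2 * \<alpha>)"
    and Hmax: "Hmax = (MAX l. Hd l)"
    and "0 < \<kappa>"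
    and \<epsilon>: "\<epsilon> = \<kappa> / (3 * K)" and "\<epsilon> < (MIN l. \<alpha>' $ l)"
  \<comment> \<open>rate of convergence of the optimal values of the finite models, with constant \<open>Yv\<close>\<close>
    and Yv: "\<And>m N. m \<in> {k, k - \<epsilon> *\<^sub>R 1} \<Longrightarrow> 1 \<le> N \<Longrightarrow>
           feasible \<beta> (finite_model M (G N) (Q N) (\<nu> N)) m \<noteq> {} \<Longrightarrow>
           \<bar>opt_value \<beta> (finite_model M (G N) (Q N) (\<nu> N)) m - opt_value \<beta> M m\<bar>
             \<le> Yv * (1 / real N) powr (1 / real CARD('d))"
    and "1 \<le> n"
    and "real n \<ge> Max {(3 * Yv / \<kappa>) ^ CARD('d), (3 * Hc / \<kappa>) ^ CARD('d),
                        (3 * Hmax * K / \<kappa>) ^ CARD('d)}"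
  \<comment> \<open>the policies\<close>
    and "\<phi> \<in> stationary_kernels (finite_model M (G n) (Q n) (\<nu> n))"
    and "optimal \<beta> (finite_model M (G n) (Q n) (\<nu> n)) (k - \<epsilon> *\<^sub>R 1) (stationary_policy \<phi>)"
    and "optimal \<beta> (averaged_model M (Q n) (\<nu> n)) (k - \<epsilon> *\<^sub>R 1)
           (stationary_policy (extension (Q n) \<phi>))"
  shows "extension (Q n) \<phi> \<in> stationary_kernels M
    \<and> stationary_policy (extension (Q n) \<phi>) \<in> feasible \<beta> M k
    \<and> \<bar>disc \<beta> M c (stationary_policy (extension (Q n) \<phi>)) - opt_value \<beta> M k\<bar> \<le> \<kappa>"
proof -
  note p_kernel = assms(3)
    and \<gamma>_prob = assms(4)
    and c_cont = assms(5)
    and d_cont = assms(6)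
    and c_pos = assms(7)
    and slater = assms(14)
    and G_sub = assms(16)
    and card_G = assms(17)
    and grid = assms(18)
    and Q_measurable = assms(19)
    and dist_Q = assms(20)
    and sets_nu = assms(21)
    and finite_nu = assms(22)
    and cell_nu = assms(23)
    and c_lipschitz = assms(25)
    and d_lipschitz = assms(26)
    and tv_lipschitz = assms(27)
    and \<epsilon>_small = assms(35)
    and n_large = assms(38)
    and \<phi> = assms(39)
    and finite_optimal = assms(40)
    and averaged_optimal = assms(41)
    and \<alpha>'_pos = assms(13)
  let ?D = "CARD('d)" and ?\<phi> = "extension (Q n) \<phi>"
  define \<eta> where "\<eta> = (1 / real n) powr (1 / real ?D)"
  define C where "C = sup_norm_on (X \<times> A) c"
  define m where "m = (MIN l. \<alpha>' $ l)"
  have M_simps: "states M = restrict_space borel X" "actions M = restrict_space borel A"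
    "trans M = p" "init M = \<gamma>" "cost M = c" "constr M = d"
    by (simp_all add: M)
  have spaces: "space (states M) = X" "space (actions M) = A" "space (pair_space M) = X \<times> A"
    by (simp_all add: M_simps pair_space_def space_pair_measure space_restrict_space)
  interpret mdp M
    by unfold_locales (use p_kernel \<gamma>_prob in \<open>simp_all add: M_simps pair_space_def\<close>)
  have \<eta>: "0 \<le> \<eta>" by (simp add: \<eta>_def)
  have "finite (G n)" using card_G[OF \<open>1 \<le> n\<close>] \<open>1 \<le> n\<close> by (intro card_ge_0_finite) simp
  interpret quantization M "G n" "Q n" "\<nu> n"
    by (intro quantization.intro quantization_axioms.intro mdp_axioms)
      (use \<open>1 \<le> n\<close> \<open>finite (G n)\<close> Q_measurable sets_nu finite_nu cell_nu in \<open>simp_all add: M_simps\<close>)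
  let ?avg = "averaged_model M (Q n) (\<nu> n)" and ?fin = "finite_model M (G n) (Q n) (\<nu> n)"
  have bounded: "bdd_above ((\<lambda>z. \<bar>f z\<bar>) ` (X \<times> A))" if "continuous_on (X \<times> A) f" for f :: "(real ^ 'd) \<times> 'a \<Rightarrow> real"
    using compact_continuous_image[OF continuous_on_rabs[OF that] compact_Times[OF \<open>compact X\<close> \<open>compact A\<close>]]
    by (simp add: bounded_imp_bdd_above compact_imp_bounded)
  have norm_bound: "\<bar>f z\<bar> \<le> sup_norm_on (X \<times> A) f" if "continuous_on (X \<times> A) f" "z \<in> space (pair_space M)"
    for f :: "(real ^ 'd) \<times> 'a \<Rightarrow> real" and z
    unfolding sup_norm_on_def using that by (intro cSUP_upper bounded) (simp_all add: spaces)
  have measurable: "f \<in> borel_measurable (pair_space M)" if "continuous_on (X \<times> A) f"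
    for f :: "(real ^ 'd) \<times> 'a \<Rightarrow> real"
  proof -
    have "(\<lambda>z. z) \<in> pair_space M \<rightarrow>\<^sub>M borel"
      unfolding pair_space_def M_simps borel_prod[symmetric]
      by (intro measurable_pair) (auto simp: comp_def intro!: measurable_compose[OF measurable_fst]
        measurable_compose[OF measurable_snd] measurable_restrict_space1)
    then have "(\<lambda>z. z) \<in> pair_space M \<rightarrow>\<^sub>M restrict_space borel (X \<times> A)"
      by (rule measurable_restrict_space2[rotated]) (simp add: spaces)
    from measurable_compose[OF this borel_measurable_continuous_on_restrict[OF that]] show ?thesis by simp
  qed
  have near: "dist x z \<le> 2 * \<alpha> * \<eta>" if "x \<in> X" "z \<in> X" "Q n z = Q n x" for x z
  proof -
    have "dist y (Q n y) \<le> \<alpha> * \<eta>" if "y \<in> X" for y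
      using dist_Q[OF \<open>1 \<le> n\<close> that] grid[OF \<open>1 \<le> n\<close> that] by (simp add: \<eta>_def)
    from this[OF that(1)] this[OF that(2)] that(3) dist_triangle2[of x z "Q n x"] show ?thesis by simp
  qed
  \<comment> \<open>A policy assigns probability measures, so \<open>X\<close> and \<open>A\<close> are nonempty.\<close>
  obtain z0 where z0: "z0 \<in> X \<times> A"
  proof -
    obtain \<pi> where "\<pi> \<in> policies M" using slater by blast
    from marginal_in_prob_algebra[OF this, of 0]
    have prob: "prob_space (marginal \<pi> 0)" and sets: "sets (marginal \<pi> 0) = sets (pair_space M)"
      by (simp_all add: space_prob_algebra)
    have "space (pair_space M) \<noteq> {}"
      using prob_space.not_empty[OF prob] sets_eq_imp_space_eq[OF sets] by simp
    then show ?thesis using that spaces by auto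
  qed
  \<comment> \<open>Two distinct states are needed here; the grid with two points supplies them.\<close>
  have "0 \<le> Gp"
  proof -
    have "card (G 2) = 2" "G 2 \<subseteq> X" using card_G[of 2] G_sub[of 2] by auto
    then obtain x y where "x \<in> X" "y \<in> X" "x \<noteq> y" by (auto simp: card_2_iff)
    moreover obtain a where "a \<in> A" using z0 by auto
    ultimately have tv: "tv_dist (p (x, a)) (p (y, a)) \<le> Gp * dist x y" and "0 < dist x y"
      using tv_lipschitz by auto
    have P: "p (x, a) \<in> space (prob_algebra (states M))" "p (y, a) \<in> space (prob_algebra (states M))"
      using measurable_space[OF trans_kernel, of "(x, a)"] measurable_space[OF trans_kernel, of "(y, a)"]
        \<open>x \<in> X\<close> \<open>y \<in> X\<close> \<open>a \<in> A\<close> by (simp_all add: spaces M_simps(3))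
    have "0 \<le> tv_dist (p (x, a)) (p (y, a))"
      using bounded_integral_diff_le_tv_dist[OF P, of "\<lambda>_. 0" 1] by simp
    with tv have "0 \<le> Gp * dist x y" by linarith
    with \<open>0 < dist x y\<close> show ?thesis by (simp add: zero_le_mult_iff)
  qed
  have \<phi>_ext: "?\<phi> \<in> stationary_kernels M"
    using \<phi> measurable_compose[OF Q]
    by (simp add: stationary_kernels_def lumped_simps extension_def)
  have policy: "stationary_policy ?\<phi> \<in> policies M" by (rule stationary_policy_in_policies[OF \<phi>_ext])
  have close: "\<bar>disc \<beta> M f (stationary_policy ?\<phi>) -
      disc \<beta> ?avg (\<lambda>(x, a). cell_average f (Q n x, a)) (stationary_policy ?\<phi>)\<bar>
      \<le> (L + sup_norm_on (X \<times> A) f * Gp / (1 - \<beta>)) * (2 * \<alpha>) * \<eta>"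
    if f: "continuous_on (X \<times> A) f" and L: "\<And>a. a \<in> A \<Longrightarrow> L-lipschitz_on X (\<lambda>x. f (x, a))" for f L
  proof -
    have "0 \<le> L" using L z0 lipschitz_on_nonneg by blast
    have "\<bar>disc \<beta> M f (stationary_policy ?\<phi>) -
      disc \<beta> ?avg (\<lambda>(x, a). cell_average f (Q n x, a)) (stationary_policy ?\<phi>)\<bar>
      \<le> L * (2 * \<alpha> * \<eta>) + sup_norm_on (X \<times> A) f * (Gp * (2 * \<alpha> * \<eta>)) / (1 - \<beta>)"
    proof (rule disc_averaged_close[OF \<open>0 < \<beta>\<close> \<open>\<beta> < 1\<close> \<phi>_ext measurable[OF f] norm_bound[OF f]])
      show "0 \<le> Gp * (2 * \<alpha> * \<eta>)" using \<open>0 \<le> Gp\<close> \<open>0 < \<alpha>\<close> \<eta> by simp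
      fix x z a assume xz: "x \<in> space (states M)" "z \<in> space (states M)" "a \<in> space (actions M)" "Q n z = Q n x"
      then have "tv_dist (p (x, a)) (p (z, a)) \<le> Gp * dist x z" using tv_lipschitz by (simp add: spaces)
      also have "\<dots> \<le> Gp * (2 * \<alpha> * \<eta>)"
        using near xz \<open>0 \<le> Gp\<close> by (intro mult_left_mono) (simp_all add: spaces)
      finally show "tv_dist (trans M (x, a)) (trans M (z, a)) \<le> Gp * (2 * \<alpha> * \<eta>)" by (simp add: M_simps)
      have "\<bar>f (x, a) - f (z, a)\<bar> \<le> L * dist x z"
        using lipschitz_onD[OF L, of a x z] xz by (simp add: spaces dist_real_def)
      also have "\<dots> \<le> L * (2 * \<alpha> * \<eta>)"
        using near xz \<open>0 \<le> L\<close> by (intro mult_left_mono) (simp_all add: spaces)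
      finally show "\<bar>f (x, a) - f (z, a)\<bar> \<le> L * (2 * \<alpha> * \<eta>)" .
    qed
    also have "\<dots> = (L + sup_norm_on (X \<times> A) f * Gp / (1 - \<beta>)) * (2 * \<alpha>) * \<eta>"
      by (simp add: algebra_simps)
    finally show ?thesis .
  qed
  have "0 < m" unfolding m_def using \<alpha>'_pos by (subst Min_gr_iff) auto
  have m: "m \<le> \<alpha>' $ l" for l unfolding m_def by (rule Min_le) auto
  have c_bound: "c z \<le> C" if "z \<in> space (pair_space M)" for z
    using norm_bound[OF c_cont that] by (simp add: C_def)
  have K': "K = 2 * C / m" by (simp add: K C_def m_def)
  have "0 \<le> C" using c_bound[of z0] c_pos[OF z0] z0 by (simp add: spaces)
  then have "0 < K" using \<open>K \<noteq> 0\<close> \<open>0 < m\<close> unfolding K' by (simp add: less_le)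
  then have \<epsilon>_pos: "0 < \<epsilon>" using \<open>0 < \<kappa>\<close> by (simp add: \<epsilon>)
  have rate: "a * \<eta> \<le> b" if "(a / b) ^ ?D \<le> real n" "0 < b" for a b
  proof -
    have "a / b * \<eta> \<le> 1" unfolding \<eta>_def by (rule mult_root_inverse_le_1) (use that \<open>1 \<le> n\<close> in auto)
    then show ?thesis using \<open>0 < b\<close> by (simp add: field_simps)
  qed
  have "(3 * Yv / \<kappa>) ^ ?D \<le> real n" "(3 * Hc / \<kappa>) ^ ?D \<le> real n" "(3 * Hmax * K / \<kappa>) ^ ?D \<le> real n"
    using n_large by simp_all
  moreover have "3 * Yv / \<kappa> = Yv / (\<kappa> / 3)" "3 * Hc / \<kappa> = Hc / (\<kappa> / 3)" "3 * Hmax * K / \<kappa> = Hmax / \<epsilon>"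
    by (simp_all add: \<epsilon>)
  ultimately have n: "(Yv / (\<kappa> / 3)) ^ ?D \<le> real n" "(Hc / (\<kappa> / 3)) ^ ?D \<le> real n" "(Hmax / \<epsilon>) ^ ?D \<le> real n"
    by simp_all
  have "0 < \<kappa> / 3" using \<open>0 < \<kappa>\<close> by simp
  have "Yv * \<eta> \<le> \<kappa> / 3" "Hc * \<eta> \<le> \<kappa> / 3" "Hmax * \<eta> \<le> \<epsilon>"
    by (rule rate[OF n(1) \<open>0 < \<kappa> / 3\<close>] rate[OF n(2) \<open>0 < \<kappa> / 3\<close>] rate[OF n(3) \<epsilon>_pos])+
  have c_close: "\<bar>disc \<beta> M c (stationary_policy ?\<phi>) - disc \<beta> ?avg (cost ?avg) (stationary_policy ?\<phi>)\<bar> \<le> \<kappa> / 3"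
    using close[OF c_cont c_lipschitz] \<open>Hc * \<eta> \<le> \<kappa> / 3\<close> unfolding Hc cost_models M_simps by linarith
  have d_feasible: "disc \<beta> M (d l) (stationary_policy ?\<phi>) \<le> k $ l" for l
  proof -
    have "disc \<beta> ?avg (constr ?avg l) (stationary_policy ?\<phi>) \<le> k $ l - \<epsilon>"
      using averaged_optimal by (simp add: optimal_def feasible_def)
    moreover have "\<bar>disc \<beta> M (d l) (stationary_policy ?\<phi>) - disc \<beta> ?avg (constr ?avg l) (stationary_policy ?\<phi>)\<bar> \<le> Hd l * \<eta>"
      using close[OF d_cont d_lipschitz] unfolding Hd cost_models M_simps .
    moreover have "Hd l * \<eta> \<le> Hmax * \<eta>"
      unfolding Hmax using \<eta> by (intro mult_right_mono Max_ge) auto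
    ultimately show ?thesis using \<open>Hmax * \<eta> \<le> \<epsilon>\<close> by linarith
  qed
  have feasible: "stationary_policy ?\<phi> \<in> feasible \<beta> M k"
    using policy d_feasible by (simp add: feasible_def M_simps)
  have "disc \<beta> ?avg (cost ?avg) (stationary_policy ?\<phi>) = opt_value \<beta> ?fin (k - \<epsilon> *\<^sub>R 1)"
    using disc_lumped_eq_averaged[OF \<open>0 < \<beta>\<close> \<open>\<beta> < 1\<close> \<phi> measurable[OF c_cont] norm_bound[OF c_cont]]
    by (simp add: optimal_imp_opt_value_eq[OF finite_optimal] cost_models M_simps)
  moreover have "\<bar>opt_value \<beta> ?fin (k - \<epsilon> *\<^sub>R 1) - opt_value \<beta> M (k - \<epsilon> *\<^sub>R 1)\<bar> \<le> \<kappa> / 3"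
  proof -
    have "feasible \<beta> ?fin (k - \<epsilon> *\<^sub>R 1) \<noteq> {}" using finite_optimal by (auto simp: optimal_def)
    from Yv[OF _ \<open>1 \<le> n\<close> this] \<open>Yv * \<eta> \<le> \<kappa> / 3\<close> show ?thesis by (simp add: \<eta>_def)
  qed
  moreover have "\<bar>opt_value \<beta> M (k - \<epsilon> *\<^sub>R 1) - opt_value \<beta> M k\<bar> \<le> \<kappa> / 3"
  proof -
    obtain \<pi>' where \<pi>': "\<pi>' \<in> policies M" "\<And>l. disc \<beta> M (constr M l) \<pi>' + \<alpha>' $ l = k $ l"
      using slater by (auto simp: M_simps)
    have c_measurable: "cost M \<in> borel_measurable (pair_space M)"
      using measurable[OF c_cont] by (simp add: M_simps)
    have d_measurable: "constr M l \<in> borel_measurable (pair_space M)" for l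
      using measurable[OF d_cont] by (simp add: M_simps)
    have cost_nonneg: "0 \<le> cost M z" and cost_le: "cost M z \<le> C" if "z \<in> space (pair_space M)" for z
      using c_pos[of z] c_bound[OF that] that by (simp_all add: M_simps spaces)
    have constr_bound: "\<bar>constr M l z\<bar> \<le> sup_norm_on (X \<times> A) (d l)" if "z \<in> space (pair_space M)" for l z
      using norm_bound[OF d_cont that] by (simp add: M_simps)
    have "\<epsilon> < m" using \<epsilon>_small by (simp add: m_def)
    note opt_value_tighten[OF mdp_axioms \<open>0 < \<beta>\<close> \<open>\<beta> < 1\<close> c_measurable cost_nonneg cost_le
        d_measurable constr_bound \<pi>' m \<epsilon>_pos this]
    \<comment> \<open>\<open>K\<close> is twice the constant \<open>C / m\<close> that the mixing argument gives.\<close>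
    moreover have "\<epsilon> * C / m = \<kappa> / 6"
      using \<open>0 < K\<close> \<open>0 < m\<close> unfolding \<epsilon> K' by (simp add: field_simps)
    ultimately show ?thesis using \<open>0 < \<kappa>\<close> by simp
  qed
  ultimately have "\<bar>disc \<beta> M c (stationary_policy ?\<phi>) - opt_value \<beta> M k\<bar> \<le> \<kappa>"
    using c_close by linarith
  with \<phi>_ext feasible show ?thesis by blast
qed

end
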